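(* We have $$T_{cap} = \frac{1}{p_{av}}, \qquad p_{av} = \frac{1}{\#\Omega_{conf}}\sum_{p \in \Omega_{conf}} p ,$$ where $p_{av}$ is the configuration averaged detection probability. Moreover, a random detection scheme $\Pi$ (that is, for each $n$ a random $(n,r(n))$-detection scheme $\Pi$ with distribution $\mathbb{P}_{sch}=\mathbb{P}_{sch}(n,r(n))$, where $r(n)\to\infty$ as $n \to \infty$) achieves a detection time of $T_{cap}$ if and only if the following two conditions hold for any fixed integer $k \geq 1$: (a1) $a_k := \mathbb{P}_{sch}\left(\#\{\Pi(1),\ldots,\Pi(k)\} = k\right) \longrightarrow 1$ as $n \to \infty$; (a2) if $\Pi_1$ and $\Pi_2$ are two independent detection schemes having the same distribution as $\Pi$, then $$b_k := \mathbb{P}_{sch}\left(\{\Pi_1(1),\ldots,\Pi_1(k)\} \cap \{\Pi_2(1),\ldots,\Pi_2(k)\} = \emptyset\right) \longrightarrow 1$$ as $n \to \infty$.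
   Context: Configurations. $\Omega_{conf}\subset(0,1)$ is a fixed finite set. There are $n$ detectors labelled $1,\ldots,n$; the detection probability vector $\underline{p}=(p_1,\ldots,p_n)\in\Omega_{conf}^n$ (a configuration) is random with i.i.d. components, each uniformly distributed on $\Omega_{conf}$; $\mathbb{P}_{conf}$ and $\mathbb{E}_{conf}$ denote its law on $\Omega_{conf}^n$ and the corresponding expectation. Detection schemes. For integers $n,r\ge1$, an $(n,r)$-detection scheme is a map $\pi:\{1,\ldots,r\}\to\{1,\ldots,n\}$. A random $(n,r)$-detection scheme $\Pi$ is a random element of the finite set of all $(n,r)$-detection schemes, with some distribution $\mathbb{P}_{sch}=\mathbb{P}_{sch}(n,r)$, independent of the configuration and of the decisions of the detectors. The quantities $a_k,b_k$ are considered for $n$ large enough that $r(n)\ge k$; in $b_k$ the probability is with respect to the joint law of the independent pair $(\Pi_1,\Pi_2)$. Detection time. For fixed $\underline{p}$ and $\pi$, let $D_i(t)$, $1\le i\le n$, $1\le t\le r$ (the decision of detector $i$ in time slot $t$), be independent $\{0,1\}$-valued random variables with $\mathbb{P}(D_i(t)=1)=p_i$. Put $T_{det}=\min\{1\le t\le r: D_{\pi(t)}(t)=1\}$, and $T_{det}=\infty$ if there is no such $t$. Let $\mathbb{P}^{(\pi,\underline{p})}$, $\mathbb{E}^{(\pi,\underline{p})}$ denote the corresponding probability and expectation; with $q_i=1-p_i$, $\mathbb{P}^{(\pi,\underline{p})}(T_{det}=k)=(1-q_{\pi(k)})\prod_{i=1}^{k-1}q_{\pi(i)}$ for $1\le k\le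 r$. Let $\mathbf{1}(\cdot)$ denote the indicator. For a configuration $\underline{p}$ and a distribution $\mathbb{P}_{sch}$ define $$S(\underline{p})=\sum_\pi \mathbb{P}^{(\pi,\underline{p})}(T_{det}<\infty)\,\mathbb{P}_{sch}(\pi),\qquad T(\underline{p})=\sum_\pi \mathbb{E}^{(\pi,\underline{p})}\big(T_{det}\mathbf{1}(T_{det}<\infty)\big)\,\mathbb{P}_{sch}(\pi).$$ Achievability. For $s,\epsilon,\delta>0$ consider the condition $$( * )\qquad \mathbb{P}_{conf}\big(\{\underline{p}\in\Omega_{conf}^n: S(\underline{p})>1-\epsilon \text{ and } T(\underline{p})<s+\delta\}\big)>1-\epsilon .$$ A detection time $s>0$ is achievable if for every $\epsilon,\delta>0$ there are an integer $N=N(\epsilon,\delta)\ge1$, a sequence $r=r(n)\to\infty$ (as $n\to\infty$) and distributions $\mathbb{P}_{sch}=\mathbb{P}_{sch}(n,r(n))$ on $(n,r(n))$-detection schemes such that $( * )$ holds for all $n\ge N$. A detection time $s>0$ is achieved by a random detection scheme $\Pi$ (given for each $n$, with $r(n)\to\infty$) if, for the distributions $\mathbb{P}_{sch}$ of $\Pi$, for every $\epsilon,\delta>0$ there is $N=N(\epsilon,\delta)$ such that $( * )$ holds for all $n\ge N$. The detection capacity is $T_{cap}=\inf\{s>0: s\text{ is achievable}\}$.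
   Formalization: The "only if" direction is stated only when Ω_conf has at least two elements: if Ω_conf={p}, every scheme (e.g. Π(t)=1 for all t) achieves 1/p though (a1), (a2) fail. The capacity formula and the "if" direction cover every nonempty Ω_conf. *)

theory Defs
  imports "HOL-Probability.Probability"
begin

text \<open>
  A configuration is an extensional function in \<open>{1..n} \<rightarrow>\<^sub>E \<Omega>\<close>, an \<open>(n,r)\<close>-detection scheme
  an extensional function in \<open>{1..r} \<rightarrow>\<^sub>E {1..n}\<close>.
\<close>

definition conf_pmf :: "real set \<Rightarrow> nat \<Rightarrow> (nat \<Rightarrow> real) pmf" where
  "conf_pmf \<Omega> n = Pi_pmf {1..n} undefined (\<lambda>_. pmf_of_set \<Omega>)"

definition p_av :: "real set \<Rightarrow> real" where
  "p_av \<Omega> = (\<Sum>p\<in>\<Omega>. p) / real (card \<Omega>)"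

definition detection_schemes :: "nat \<Rightarrow> nat \<Rightarrow> (nat \<Rightarrow> nat) set" where
  "detection_schemes n r = {1..r} \<rightarrow>\<^sub>E {1..n}"

text \<open>The component \<open>(i, t)\<close> is the decision of detector \<open>i\<close> in time slot \<open>t\<close>.\<close>

definition decisions_pmf :: "nat \<Rightarrow> nat \<Rightarrow> (nat \<Rightarrow> real) \<Rightarrow> (nat \<times> nat \<Rightarrow> bool) pmf" where
  "decisions_pmf n r p = Pi_pmf ({1..n} \<times> {1..r}) False (\<lambda>(i, t). bernoulli_pmf (p i))"

text \<open>In \<open>enat\<close>, the infimum of the empty set is \<open>\<infinity>\<close>.\<close>

definition T_det :: "nat \<Rightarrow> (nat \<Rightarrow> nat) \<Rightarrow> (nat \<times> nat \<Rightarrow> bool) \<Rightarrow> enat" where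
  "T_det r \<pi> D = Inf (enat ` {t \<in> {1..r}. D (\<pi> t, t)})"

definition detection_prob ::
  "nat \<Rightarrow> nat \<Rightarrow> (nat \<Rightarrow> nat) pmf \<Rightarrow> (nat \<Rightarrow> real) \<Rightarrow> real" where
  "detection_prob n r P p =
     (\<Sum>\<pi>\<in>detection_schemes n r.
        measure_pmf.prob (decisions_pmf n r p) {D. T_det r \<pi> D < \<infinity>} * pmf P \<pi>)"

definition mean_detection_time ::
  "nat \<Rightarrow> nat \<Rightarrow> (nat \<Rightarrow> nat) pmf \<Rightarrow> (nat \<Rightarrow> real) \<Rightarrow> real" where
  "mean_detection_time n r P p =
     (\<Sum>\<pi>\<in>detection_schemes n r.
        measure_pmf.expectation (decisions_pmf n r p)
          (\<lambda>D. if T_det r \<pi> D < \<infinity> then real (the_enat (T_det r \<pi> D)) else 0) * pmf P \<pi>)"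

definition achievability_condition ::
  "real set \<Rightarrow> nat \<Rightarrow> nat \<Rightarrow> (nat \<Rightarrow> nat) pmf \<Rightarrow> real \<Rightarrow> real \<Rightarrow> real \<Rightarrow> bool" where
  "achievability_condition \<Omega> n r P s \<epsilon> \<delta> \<longleftrightarrow>
     measure_pmf.prob (conf_pmf \<Omega> n)
       {p. detection_prob n r P p > 1 - \<epsilon> \<and> mean_detection_time n r P p < s + \<delta>} > 1 - \<epsilon>"

text \<open>The values of \<open>r\<close> and \<open>P\<close> at \<open>n = 0\<close> are irrelevant: there are no \<open>(0,r)\<close>-schemes with \<open>r \<ge> 1\<close>.\<close>

definition random_scheme :: "(nat \<Rightarrow> nat) \<Rightarrow> (nat \<Rightarrow> (nat \<Rightarrow> nat) pmf) \<Rightarrow> bool" where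
  "random_scheme r P \<longleftrightarrow>
     (\<forall>n\<ge>1. r n \<ge> 1 \<and> set_pmf (P n) \<subseteq> detection_schemes n (r n)) \<and>
     filterlim r at_top sequentially"

definition achievable :: "real set \<Rightarrow> real \<Rightarrow> bool" where
  "achievable \<Omega> s \<longleftrightarrow>
     s > 0 \<and>
     (\<forall>\<epsilon>>0. \<forall>\<delta>>0. \<exists>N\<ge>1. \<exists>r P. random_scheme r P \<and>
        (\<forall>n\<ge>N. achievability_condition \<Omega> n (r n) (P n) s \<epsilon> \<delta>))"

definition achieved_by ::
  "real set \<Rightarrow> (nat \<Rightarrow> nat) \<Rightarrow> (nat \<Rightarrow> (nat \<Rightarrow> nat) pmf) \<Rightarrow> real \<Rightarrow> bool" where
  "achieved_by \<Omega> r P s \<longleftrightarrow>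
     s > 0 \<and> random_scheme r P \<and>
     (\<forall>\<epsilon>>0. \<forall>\<delta>>0. \<exists>N\<ge>1. \<forall>n\<ge>N. achievability_condition \<Omega> n (r n) (P n) s \<epsilon> \<delta>)"

text \<open>Taken in \<open>ereal\<close>, so that the infimum would be \<open>\<infinity>\<close> if no detection time were achievable.\<close>

definition T_cap :: "real set \<Rightarrow> ereal" where
  "T_cap \<Omega> = Inf (ereal ` {s. achievable \<Omega> s})"

definition distinct_prob :: "(nat \<Rightarrow> nat) pmf \<Rightarrow> nat \<Rightarrow> real" where
  "distinct_prob P k = measure_pmf.prob P {\<pi>. card (\<pi> ` {1..k}) = k}"

definition disjoint_prob :: "(nat \<Rightarrow> nat) pmf \<Rightarrow> nat \<Rightarrow> real" where
  "disjoint_prob P k =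
     measure_pmf.prob (pair_pmf P P) {(\<pi>\<^sub>1, \<pi>\<^sub>2). \<pi>\<^sub>1 ` {1..k} \<inter> \<pi>\<^sub>2 ` {1..k} = {}}"

end

theory Submission
  imports Defs "HOL-Library.Discrete_Functions"
begin

text \<open>
  Write \<open>q\<^sub>i = 1 - p\<^sub>i\<close>.  In a fixed scheme \<open>\<pi>\<close> the detection time exceeds \<open>k\<close> with probability
  \<open>q\<^bsub>\<pi> 1\<^esub> \<cdots> q\<^bsub>\<pi> k\<^esub>\<close>, so the mean detection time \<open>T p\<close> is, up to a term that vanishes as \<open>r \<rightarrow> \<infinity>\<close>,
  the sum over \<open>k < r\<close> of the averages of these products over the random scheme.  If the detectors
  used are distinct, the mean of such a product over the configuration is \<open>q_av ^ k\<close>, and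
  \<open>\<Sum>k. q_av ^ k = 1 / p_av\<close>.

  Everything rests on one estimate, \<open>mean_miss_lower\<close>: for any list of detectors the mean of the
  product of the corresponding \<open>q\<close> is at least \<open>q_av\<close> to the power of its length, and a list with a
  repetition exceeds this by at least a positive multiple of the variance of \<open>q\<close>, because a repeated detector
  contributes positively correlated factors.

  The estimate is applied to the square of the truncated time \<open>trunc_time P K\<close>, whose expectation is
  an average of such means over the concatenated first slots of two independent copies of the
  scheme.  A repetition in the concatenated list is either a repetition within one copy or a detector
  shared by both, so the probability \<open>repeat_prob\<close> of a repetition tends to 0 exactly if both
  conditions of the theorem hold (\<open>repeat_prob_tendsto_0_iff\<close>).  The second moment thus lies between
  \<open>(\<Sum>k<K. q_av ^ k)\<^sup>2\<close> plus a multiple of a repetition probability and the same square plus another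
  multiple of a repetition probability (\<open>second_moment_lower\<close>, \<open>second_moment_upper\<close>).

  If \<open>s\<close> is achievable, then \<open>T\<close> is close to at most \<open>s\<close> off a small event, on which it is still bounded,
  so the second moment is at most \<open>s\<^sup>2\<close> plus a small error.  The lower estimate then gives \<open>1 / p_av \<le> s\<close>,
  and if \<open>s = 1 / p_av\<close> and the variance is positive it forces the repetition probabilities to 0.
  Conversely, if these probabilities tend to 0, the second moment tends to the square of the lower bound
  \<open>\<Sum>k<K. q_av ^ k\<close> of the first, and Chebyshev's inequality shows that the truncated time
  concentrates at this value.  The capacity is attained by querying a random block of detectors.
\<close>

section \<open>Moments of the non-detection probability\<close>

lemma mult_diff_power_Suc_lower:
  fixes a b c :: real
  assumes "0 \<le> c" "c \<le> a" "c \<le> b"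
  shows "(a - b)\<^sup>2 * c ^ m \<le> (a - b) * (a ^ Suc m - b ^ Suc m)"
proof (induction m)
  case 0
  show ?case by (simp add: power2_eq_square)
next
  case (Suc m)
  have "0 \<le> (a - b)\<^sup>2 * c ^ m" using assms by simp
  also note Suc
  finally have "0 \<le> a * ((a - b) * (a ^ Suc m - b ^ Suc m))"
    using assms by simp
  moreover have "(a - b)\<^sup>2 * c ^ Suc m \<le> (a - b)\<^sup>2 * b ^ Suc m"
    using assms by (intro mult_left_mono power_mono) auto
  moreover have "(a - b) * (a ^ Suc (Suc m) - b ^ Suc (Suc m)) =
      a * ((a - b) * (a ^ Suc m - b ^ Suc m)) + (a - b)\<^sup>2 * b ^ Suc m"
    by (simp add: power2_eq_square algebra_simps)
  ultimately show ?case by linarith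
qed

text \<open>
  The probability that all the detectors listed in \<open>xs\<close> fail in the slots assigned to them; a detector
  used in several slots occurs several times.
\<close>

definition miss_prob :: "(nat \<Rightarrow> real) \<Rightarrow> nat list \<Rightarrow> real" where
  "miss_prob p xs = (\<Prod>x\<leftarrow>xs. 1 - p x)"

lemma miss_prob_append: "miss_prob p (xs @ ys) = miss_prob p xs * miss_prob p ys"
  by (simp add: miss_prob_def)

lemma miss_prob_eq_prod_count:
  "set xs \<subseteq> A \<Longrightarrow> finite A \<Longrightarrow> miss_prob p xs = (\<Prod>i\<in>A. (1 - p i) ^ count_list xs i)"
proof (induction xs)
  case Nil
  then show ?case by (simp add: miss_prob_def)
next
  case (Cons x xs)
  have "(\<Prod>i\<in>A. (1 - p i) ^ count_list (x # xs) i) =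
      (\<Prod>i\<in>A. (if i = x then 1 - p i else 1) * (1 - p i) ^ count_list xs i)"
    by (intro prod.cong) auto
  also have "\<dots> = (1 - p x) * (\<Prod>i\<in>A. (1 - p i) ^ count_list xs i)"
    using Cons.prems by (simp add: prod.distrib)
  finally show ?case using Cons by (simp add: miss_prob_def)
qed

locale detector_probabilities =
  fixes \<Omega> :: "real set"
  assumes finite_\<Omega>: "finite \<Omega>" and nonempty_\<Omega>: "\<Omega> \<noteq> {}" and \<Omega>_subset: "\<Omega> \<subseteq> {0<..<1}"
begin

definition q_min :: real where "q_min = 1 - Max \<Omega>"

definition q_max :: real where "q_max = 1 - Min \<Omega>"

definition q_moment :: "nat \<Rightarrow> real" where
  "q_moment m = (\<Sum>p\<in>\<Omega>. (1 - p) ^ m) / card \<Omega>"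

definition q_av :: real where "q_av = q_moment 1"

definition q_var :: real where
  "q_var = (\<Sum>p\<in>\<Omega>. (1 - p - q_av)\<^sup>2) / card \<Omega>"

lemma card_pos: "card \<Omega> > 0"
  using finite_\<Omega> nonempty_\<Omega> by (simp add: card_gt_0_iff)

lemma q_min_le: "p \<in> \<Omega> \<Longrightarrow> q_min \<le> 1 - p"
  and q_max_ge: "p \<in> \<Omega> \<Longrightarrow> 1 - p \<le> q_max"
  using finite_\<Omega> by (auto simp: q_min_def q_max_def)

lemma q_min_pos: "0 < q_min"
  using Max_in[OF finite_\<Omega> nonempty_\<Omega>] \<Omega>_subset by (auto simp: q_min_def)

lemma q_max_pos: "0 < q_max" and q_max_less_1: "q_max < 1"
  using Min_in[OF finite_\<Omega> nonempty_\<Omega>] \<Omega>_subset by (auto simp: q_max_def)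

lemma q_moment_0 [simp]: "q_moment 0 = 1"
  using card_pos by (simp add: q_moment_def)

lemma q_moment_ge_power: "q_min ^ m \<le> q_moment m"
proof -
  have "card \<Omega> * q_min ^ m \<le> (\<Sum>p\<in>\<Omega>. (1 - p) ^ m)"
    using q_min_le q_min_pos by (intro sum_bounded_below power_mono) auto
  then show ?thesis
    using card_pos by (simp add: q_moment_def field_simps)
qed

lemma q_av_le_q_max: "q_av \<le> q_max"
proof -
  have "(\<Sum>p\<in>\<Omega>. (1 - p) ^ 1) \<le> card \<Omega> * q_max"
    using q_max_ge by (intro sum_bounded_above) auto
  then show ?thesis
    using card_pos by (simp add: q_av_def q_moment_def field_simps)
qed

lemma q_min_le_q_av: "q_min \<le> q_av"
  using q_moment_ge_power[of 1] by (simp add: q_av_def)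

lemma q_av_pos: "0 < q_av" and q_av_less_1: "q_av < 1"
  using q_min_le_q_av q_min_pos q_av_le_q_max q_max_less_1 by auto

lemma p_av_eq: "p_av \<Omega> = 1 - q_av"
  using card_pos
  by (simp add: q_av_def q_moment_def p_av_def sum_subtractf diff_divide_distrib)

lemma q_var_nonneg: "0 \<le> q_var"
  by (simp add: q_var_def sum_nonneg)

lemma q_var_pos:
  assumes "card \<Omega> \<ge> 2"
  shows "0 < q_var"
proof -
  obtain a where a: "a \<in> \<Omega>" "1 - a \<noteq> q_av"
  proof (rule ccontr)
    assume "\<not> thesis"
    then have "\<Omega> \<subseteq> {1 - q_av}" using that by force
    then have "card \<Omega> \<le> card {1 - q_av}" by (rule card_mono[rotated]) simp
    then show False using assms by simp
  qed
  have "0 < (\<Sum>p\<in>\<Omega>. (1 - p - q_av)\<^sup>2)"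
    by (rule sum_pos2[of _ a]) (use a finite_\<Omega> in auto)
  then show ?thesis using card_pos by (simp add: q_var_def)
qed

text \<open>
  For \<open>q = 1 - p\<close> with \<open>p\<close> uniform on \<open>\<Omega>\<close>, the difference of the two moment terms is the covariance of
  \<open>q\<close> and \<open>q ^ (m + 1)\<close>, that is, the mean of \<open>(q - q_av) * (q ^ (m + 1) - q_av ^ (m + 1))\<close>.  The two
  factors have the same sign, and in absolute value the second is at least \<open>q_min ^ m\<close> times the first.
\<close>

lemma q_moment_Suc_Suc_lower:
  "q_av * q_moment (Suc m) + q_var * q_min ^ m \<le> q_moment (Suc (Suc m))"
proof -
  define c where "c = real (card \<Omega>)"
  have c: "c > 0" using card_pos by (simp add: c_def)
  have centred: "(\<Sum>p\<in>\<Omega>. 1 - p - q_av) = 0"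
    using c by (simp add: sum_subtractf q_av_def q_moment_def c_def)
  have "c * (q_var * q_min ^ m) = (\<Sum>p\<in>\<Omega>. (1 - p - q_av)\<^sup>2 * q_min ^ m)"
    using c by (simp add: q_var_def c_def sum_distrib_right)
  also have "\<dots> \<le> (\<Sum>p\<in>\<Omega>. (1 - p - q_av) * ((1 - p) ^ Suc m - q_av ^ Suc m))"
    using q_min_pos q_min_le q_min_le_q_av
    by (intro sum_mono mult_diff_power_Suc_lower) auto
  also have "\<dots> = (\<Sum>p\<in>\<Omega>. (1 - p) ^ Suc (Suc m)) - q_av * (\<Sum>p\<in>\<Omega>. (1 - p) ^ Suc m)
      - (\<Sum>p\<in>\<Omega>. 1 - p - q_av) * q_av ^ Suc m"
    unfolding sum_distrib_left sum_distrib_right sum_subtractf[symmetric]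
    by (intro sum.cong) (auto simp: algebra_simps)
  also have "\<dots> = c * (q_moment (Suc (Suc m)) - q_av * q_moment (Suc m))"
    unfolding centred using c by (simp add: q_moment_def c_def field_simps)
  finally show ?thesis using c by simp
qed

section \<open>Repeated detectors raise the mean miss probability\<close>

lemma set_conf_pmf: "set_pmf (conf_pmf \<Omega> n) = PiE_dflt {1..n} undefined (\<lambda>_. \<Omega>)"
  using finite_\<Omega> nonempty_\<Omega> by (simp add: conf_pmf_def set_Pi_pmf o_def)

lemma finite_set_conf_pmf: "finite (set_pmf (conf_pmf \<Omega> n))"
  unfolding set_conf_pmf using finite_\<Omega> by (intro finite_PiE_dflt) auto

lemma integrable_conf_pmf: "integrable (conf_pmf \<Omega> n) (f :: _ \<Rightarrow> real)"
  by (rule integrable_measure_pmf_finite[OF finite_set_conf_pmf])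

lemma conf_in_\<Omega>: "p \<in> set_pmf (conf_pmf \<Omega> n) \<Longrightarrow> i \<in> {1..n} \<Longrightarrow> p i \<in> \<Omega>"
  unfolding set_conf_pmf by (auto simp: PiE_dflt_def)

definition mean_miss :: "nat \<Rightarrow> nat list \<Rightarrow> real" where
  "mean_miss n xs = measure_pmf.expectation (conf_pmf \<Omega> n) (\<lambda>p. miss_prob p xs)"

text \<open>
  Distinct components of the configuration are independent, so only the multiplicities in the list
  matter.
\<close>

lemma mean_miss_eq_prod_moments:
  assumes "set xs \<subseteq> {1..n}"
  shows "mean_miss n xs = (\<Prod>i\<in>{1..n}. q_moment (count_list xs i))"
proof -
  have set: "set_pmf (pmf_of_set \<Omega>) = \<Omega>" by (rule set_pmf_of_set[OF nonempty_\<Omega> finite_\<Omega>])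
  have "mean_miss n xs = measure_pmf.expectation (conf_pmf \<Omega> n)
      (\<lambda>p. \<Prod>i\<in>{1..n}. (1 - p i) ^ count_list xs i)"
    using assms by (simp add: mean_miss_def miss_prob_eq_prod_count[of xs "{1..n}"])
  also have "\<dots> = (\<Prod>i\<in>{1..n}. measure_pmf.expectation (pmf_of_set \<Omega>)
      (\<lambda>v. (1 - v) ^ count_list xs i))"
    unfolding conf_pmf_def
    using set \<Omega>_subset finite_\<Omega>
    by (intro expectation_prod_Pi_pmf integrable_measure_pmf_finite) auto
  also have "\<dots> = (\<Prod>i\<in>{1..n}. q_moment (count_list xs i))"
    using finite_\<Omega> nonempty_\<Omega> by (simp add: integral_pmf_of_set q_moment_def)
  finally show ?thesis .
qed

lemma count_list_distinct: "distinct xs \<Longrightarrow> x \<in> set xs \<Longrightarrow> count_list xs x = 1"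
  by (induction xs) (auto simp: count_list_0_iff)

lemma mean_miss_distinct:
  assumes "distinct xs" "set xs \<subseteq> {1..n}"
  shows "mean_miss n xs = q_av ^ length xs"
proof -
  have "mean_miss n xs = (\<Prod>i\<in>{1..n}. if i \<in> set xs then q_av else 1)"
    unfolding mean_miss_eq_prod_moments[OF assms(2)]
    using assms(1) by (intro prod.cong) (auto simp: count_list_distinct q_av_def)
  also have "\<dots> = q_av ^ card (set xs)"
    using assms(2) by (simp add: prod.If_cases Int_absorb1)
  finally show ?thesis using assms(1) by (simp add: distinct_card)
qed

text \<open>
  A new detector \<open>x\<close> multiplies the mean by \<open>q_av\<close>, by independence.  A detector that has occurred before
  multiplies it by at least that much, because powers of the same \<open>1 - p x\<close> are positively correlated;
  the surplus is bounded below uniformly over all lists of a given length.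
\<close>

lemma mean_miss_Cons_lower:
  assumes "set (x # xs) \<subseteq> {1..n}"
  shows "q_av * mean_miss n xs + of_bool (x \<in> set xs) * (q_var * q_min ^ length xs)
    \<le> mean_miss n (x # xs)"
proof -
  define m where "m = count_list xs x"
  define R where "R = (\<Prod>i\<in>{1..n}-{x}. q_moment (count_list xs i))"
  have x: "x \<in> {1..n}" and xs: "set xs \<subseteq> {1..n}" using assms by auto
  have mean: "mean_miss n xs = q_moment m * R"
    unfolding mean_miss_eq_prod_moments[OF xs] R_def m_def
    using x by (intro prod.remove) auto
  have "mean_miss n (x # xs) = q_moment (count_list (x # xs) x) *
      (\<Prod>i\<in>{1..n}-{x}. q_moment (count_list (x # xs) i))"
    unfolding mean_miss_eq_prod_moments[OF assms] using x by (intro prod.remove) auto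
  also have "\<dots> = q_moment (Suc m) * R"
    unfolding R_def m_def by (intro arg_cong2[where f = "(*)"] prod.cong) auto
  finally have mean_Cons: "mean_miss n (x # xs) = q_moment (Suc m) * R" .
  define l where "l = (\<Sum>i\<in>{1..n}-{x}. count_list xs i)"
  have "length xs = (\<Sum>i\<in>{1..n}. count_list xs i)"
    using sum_count_set[OF xs] by simp
  also have "\<dots> = m + l"
    unfolding m_def l_def using x by (intro sum.remove) auto
  finally have len: "length xs = m + l" .
  \<comment> \<open>The other detectors cannot make the surplus small: each moment is at least a power of \<open>q_min\<close>.\<close>
  have "q_min ^ l = (\<Prod>i\<in>{1..n}-{x}. q_min ^ count_list xs i)"
    by (simp add: l_def power_sum)
  also have "\<dots> \<le> R"
    unfolding R_def using q_moment_ge_power q_min_pos by (intro prod_mono) auto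
  finally have R: "q_min ^ l \<le> R" .
  have R0: "0 \<le> R" using R q_min_pos by (meson order_trans zero_le_power less_imp_le)
  show ?thesis
  proof (cases "x \<in> set xs")
    case False
    then have "m = 0" by (simp add: m_def count_list_0_iff)
    then show ?thesis using False mean mean_Cons by (simp add: q_av_def)
  next
    case True
    then obtain m' where m': "m = Suc m'"
      by (metis m_def count_list_0_iff not0_implies_Suc)
    have q1: "q_min \<le> 1" using q_min_le_q_av q_av_less_1 by simp
    have "q_min ^ length xs \<le> q_min ^ m' * q_min ^ l"
      unfolding len m' power_add[symmetric] using q_min_pos q1 by (intro power_decreasing) auto
    also have "\<dots> \<le> q_min ^ m' * R"
      using R q_min_pos by (intro mult_left_mono) auto
    finally have "q_var * q_min ^ length xs \<le> q_var * q_min ^ m' * R"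
      using q_var_nonneg by (simp add: mult_left_mono mult.assoc)
    moreover have "(q_av * q_moment m + q_var * q_min ^ m') * R \<le> q_moment (Suc m) * R"
      using q_moment_Suc_Suc_lower[of m'] R0 unfolding m' by (intro mult_right_mono) auto
    ultimately show ?thesis using True mean mean_Cons by (simp add: algebra_simps)
  qed
qed

text \<open>
  Every \<open>Cons\<close> step contributes a factor of at least \<open>q_av\<close>, and the first repetition met contributes
  the variance term; since \<open>q_min \<le> q_av\<close>, later steps shrink that term by at most a factor \<open>q_min\<close>.
\<close>

lemma mean_miss_lower:
  "set xs \<subseteq> {1..n} \<Longrightarrow>
    q_av ^ length xs + of_bool (\<not> distinct xs) * (q_var * q_min ^ length xs) \<le> mean_miss n xs"
proof (induction xs)
  case Nil
  then show ?case by (simp add: mean_miss_def miss_prob_def)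
next
  case (Cons x xs)
  define e where "e = q_var * q_min ^ length xs"
  have e: "0 \<le> e" using q_var_nonneg q_min_pos by (simp add: e_def)
  have "q_av * (q_av ^ length xs + of_bool (\<not> distinct xs) * e) \<le> q_av * mean_miss n xs"
    using Cons q_av_pos by (intro mult_left_mono) (auto simp: e_def)
  moreover have "of_bool (\<not> distinct (x # xs)) * (q_min * e) \<le>
      q_av * (of_bool (\<not> distinct xs) * e) + of_bool (x \<in> set xs) * e"
  proof -
    have "q_min * e \<le> q_av * e" "q_min * e \<le> 1 * e" "0 \<le> q_av * e"
      using e q_min_le_q_av q_av_less_1 q_av_pos
      by (intro mult_right_mono mult_nonneg_nonneg; simp)+
    then show ?thesis by (cases "x \<in> set xs"; cases "distinct xs") (use e in auto)
  qed
  moreover note mean_miss_Cons_lower[OF Cons.prems]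
  ultimately show ?case by (simp add: e_def algebra_simps)
qed

lemma mean_miss_ge_power:
  assumes "set xs \<subseteq> {1..n}"
  shows "q_av ^ length xs \<le> mean_miss n xs"
  by (rule order_trans[OF _ mean_miss_lower[OF assms]]) (use q_var_nonneg q_min_pos in simp)

end

section \<open>The detection time of a scheme\<close>

definition slots :: "(nat \<Rightarrow> nat) \<Rightarrow> nat \<Rightarrow> nat list" where
  "slots \<pi> k = map \<pi> [1..<Suc k]"

lemma length_slots [simp]: "length (slots \<pi> k) = k"
  by (simp add: slots_def)

lemma set_slots: "set (slots \<pi> k) = \<pi> ` {1..k}"
  by (auto simp: slots_def)

lemma take_slots: "j \<le> k \<Longrightarrow> take j (slots \<pi> k) = slots \<pi> j"
  by (simp add: slots_def take_map take_upt del: upt_Suc)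

lemma distinct_slots_iff: "distinct (slots \<pi> k) \<longleftrightarrow> card (\<pi> ` {1..k}) = k"
  using distinct_card[of "slots \<pi> k"] card_distinct[of "slots \<pi> k"] by (auto simp: set_slots)

lemma set_slots_subset:
  "\<pi> \<in> detection_schemes n r \<Longrightarrow> k \<le> r \<Longrightarrow> set (slots \<pi> k) \<subseteq> {1..n}"
  unfolding set_slots by (fastforce simp: detection_schemes_def PiE_def Pi_def)

lemma finite_detection_schemes: "finite (detection_schemes n r)"
  by (auto simp: detection_schemes_def intro: finite_PiE)

text \<open>
  The pairs \<open>(\<pi> t, t)\<close> differ in their second component, so the decisions inspected are independent
  even if the scheme uses a detector repeatedly.
\<close>

lemma prob_no_detection:
  assumes \<pi>: "\<pi> \<in> detection_schemes n r" and k: "k \<le> r"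
    and p: "\<And>i. i \<in> {1..n} \<Longrightarrow> p i \<in> {0..1}"
  shows "measure_pmf.prob (decisions_pmf n r p) {D. \<forall>t\<in>{1..k}. \<not> D (\<pi> t, t)} =
    miss_prob p (slots \<pi> k)"
proof -
  define A where "A = {1..n} \<times> {1..r}"
  define J where "J = (\<lambda>t. (\<pi> t, t)) ` {1..k}"
  define B where "B = (\<lambda>x. if x \<in> J then {False} else UNIV)"
  have J: "J \<subseteq> A"
    using \<pi> k by (fastforce simp: A_def J_def detection_schemes_def PiE_def Pi_def)
  have "{D. \<forall>t\<in>{1..k}. \<not> D (\<pi> t, t)} = Pi A B"
    using J by (auto simp: B_def J_def Pi_def)
  then have "measure_pmf.prob (decisions_pmf n r p) {D. \<forall>t\<in>{1..k}. \<not> D (\<pi> t, t)} =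
      (\<Prod>x\<in>A. measure_pmf.prob (case x of (i, t) \<Rightarrow> bernoulli_pmf (p i)) (B x))"
    unfolding decisions_pmf_def A_def[symmetric] by (simp add: measure_Pi_pmf_Pi A_def)
  also have "\<dots> = (\<Prod>x\<in>J. measure_pmf.prob (case x of (i, t) \<Rightarrow> bernoulli_pmf (p i)) (B x))"
    using J by (intro prod.mono_neutral_right) (auto simp: A_def B_def)
  also have "\<dots> = (\<Prod>x\<in>J. 1 - p (fst x))"
  proof (rule prod.cong[OF refl])
    fix x assume x: "x \<in> J"
    then have "p (fst x) \<in> {0..1}" using J by (intro p) (auto simp: A_def)
    then show "measure_pmf.prob (case x of (i, t) \<Rightarrow> bernoulli_pmf (p i)) (B x) = 1 - p (fst x)"
      using x by (auto simp: B_def measure_pmf_single split: prod.splits)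
  qed
  also have "\<dots> = (\<Prod>t\<in>{1..k}. 1 - p (\<pi> t))"
    unfolding J_def by (subst prod.reindex) (auto simp: inj_on_def)
  also have "\<dots> = miss_prob p (slots \<pi> k)"
    by (simp add: miss_prob_def slots_def prod.distinct_set_conv_list[symmetric]
        atLeastLessThanSuc_atLeastAtMost o_def del: upt_Suc)
  finally show ?thesis .
qed

lemma T_det_cases:
  obtains "T_det r \<pi> D = \<infinity>" "\<And>t. t \<in> {1..r} \<Longrightarrow> \<not> D (\<pi> t, t)"
  | m where "T_det r \<pi> D = enat m" "m \<in> {1..r}" "D (\<pi> m, m)"
      "\<And>t. t \<in> {1..r} \<Longrightarrow> D (\<pi> t, t) \<Longrightarrow> m \<le> t"
proof (cases "{t \<in> {1..r}. D (\<pi> t, t)} = {}")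
  case True
  then have "T_det r \<pi> D = \<infinity>" by (simp only: T_det_def image_empty Inf_empty top_enat_def)
  then show ?thesis using True that(1) by blast
next
  case False
  define A where "A = {t \<in> {1..r}. D (\<pi> t, t)}"
  have A: "finite A" "A \<noteq> {}" using False by (auto simp: A_def)
  have "T_det r \<pi> D = Min (enat ` A)"
    unfolding T_det_def A_def[symmetric] using A by (simp add: Min_Inf)
  also have "\<dots> = enat (Min A)"
    using A by (subst mono_Min_commute[of enat]) (auto simp: mono_def)
  finally show ?thesis
    using that(2)[of "Min A"] Min_in[OF A] Min_le[OF A(1)] by (auto simp: A_def)
qed

lemma T_det_finite_iff: "T_det r \<pi> D < \<infinity> \<longleftrightarrow> \<not> (\<forall>t\<in>{1..r}. \<not> D (\<pi> t, t))"
  by (rule T_det_cases[of r \<pi> D]) auto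

text \<open>
  A detection time \<open>m \<le> r\<close> is the number of \<open>k < r\<close> such that the slots \<open>1, \<dots>, k\<close> bring no detection;
  the subtracted indicator removes the contribution of the runs without any detection.
\<close>

lemma T_det_eq_sum_indicator:
  "(if T_det r \<pi> D < \<infinity> then real (the_enat (T_det r \<pi> D)) else 0) =
    (\<Sum>k<r. indicator {D. \<forall>t\<in>{1..k}. \<not> D (\<pi> t, t)} D - indicator {D. \<forall>t\<in>{1..r}. \<not> D (\<pi> t, t)} D)"
proof (rule T_det_cases[of r \<pi> D])
  assume "T_det r \<pi> D = \<infinity>" "\<And>t. t \<in> {1..r} \<Longrightarrow> \<not> D (\<pi> t, t)"
  then show ?thesis by (auto simp: indicator_def intro!: sum.neutral[symmetric])
next
  fix m
  assume m: "T_det r \<pi> D = enat m" "m \<in> {1..r}" "D (\<pi> m, m)"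
    "\<And>t. t \<in> {1..r} \<Longrightarrow> D (\<pi> t, t) \<Longrightarrow> m \<le> t"
  have "(\<forall>t\<in>{1..k}. \<not> D (\<pi> t, t)) \<longleftrightarrow> k < m" if "k < r" for k
    using m(2-4) that by (force simp: not_less)
  moreover have "\<not> (\<forall>t\<in>{1..r}. \<not> D (\<pi> t, t))" using m by auto
  ultimately have "(\<Sum>k<r. indicator {D. \<forall>t\<in>{1..k}. \<not> D (\<pi> t, t)} D -
      indicator {D. \<forall>t\<in>{1..r}. \<not> D (\<pi> t, t)} D :: real) = (\<Sum>k<r. of_bool (k < m))"
    by (intro sum.cong) (auto simp: indicator_def)
  also have "\<dots> = real (card {k. k < m})"
  proof -
    have "{..<r} \<inter> {k. k < m} = {k. k < m}" using m(2) by auto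
    then show ?thesis by (simp add: sum_of_bool_eq)
  qed
  finally show ?thesis using m(1) by simp
qed

lemma expectation_T_det:
  assumes \<pi>: "\<pi> \<in> detection_schemes n r" and p: "\<And>i. i \<in> {1..n} \<Longrightarrow> p i \<in> {0..1}"
  shows "measure_pmf.expectation (decisions_pmf n r p)
      (\<lambda>D. if T_det r \<pi> D < \<infinity> then real (the_enat (T_det r \<pi> D)) else 0) =
    (\<Sum>k<r. miss_prob p (slots \<pi> k)) - r * miss_prob p (slots \<pi> r)"
proof -
  let ?G = "\<lambda>k. {D. \<forall>t\<in>{1..k}. \<not> D (\<pi> t, t)}"
  have G: "measure_pmf.expectation (decisions_pmf n r p) (indicator (?G k)) =
      miss_prob p (slots \<pi> k)" if "k \<le> r" for k
    using prob_no_detection[OF \<pi> that p] by simp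
  have int: "integrable (decisions_pmf n r p) (indicator (?G k) :: _ \<Rightarrow> real)" for k
    by (rule measure_pmf.integrable_const_bound[of _ 1]) auto
  have "measure_pmf.expectation (decisions_pmf n r p)
      (\<lambda>D. \<Sum>k<r. indicat_real (?G k) D - indicat_real (?G r) D) =
    (\<Sum>k<r. measure_pmf.expectation (decisions_pmf n r p) (indicat_real (?G k)) -
      measure_pmf.expectation (decisions_pmf n r p) (indicat_real (?G r)))"
    by (subst Bochner_Integration.integral_sum)
      (intro Bochner_Integration.integrable_diff int,
       intro sum.cong refl Bochner_Integration.integral_diff int)
  also have "\<dots> = (\<Sum>k<r. miss_prob p (slots \<pi> k) - miss_prob p (slots \<pi> r))"
    using G by (intro sum.cong) auto
  finally show ?thesis unfolding T_det_eq_sum_indicator by (simp add: sum_subtractf)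
qed

section \<open>Random schemes\<close>

text \<open>
  For \<open>K \<le> r\<close> this is the mean of \<open>min T_det K\<close> in the configuration \<open>p\<close>, as a sum of tail probabilities.
  Unlike the mean detection time itself it depends on the first \<open>K\<close> slots only.
\<close>

definition trunc_time :: "(nat \<Rightarrow> nat) pmf \<Rightarrow> nat \<Rightarrow> (nat \<Rightarrow> real) \<Rightarrow> real" where
  "trunc_time P K p = measure_pmf.expectation P (\<lambda>\<pi>. \<Sum>k<K. miss_prob p (slots \<pi> k))"

definition escape_prob :: "(nat \<Rightarrow> nat) pmf \<Rightarrow> nat \<Rightarrow> (nat \<Rightarrow> real) \<Rightarrow> real" where
  "escape_prob P r p = measure_pmf.expectation P (\<lambda>\<pi>. miss_prob p (slots \<pi> r))"

definition repeat_prob :: "(nat \<Rightarrow> nat) pmf \<Rightarrow> nat \<Rightarrow> real" where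
  "repeat_prob P k =
     measure_pmf.prob (pair_pmf P P) {(\<pi>\<^sub>1, \<pi>\<^sub>2). \<not> distinct (slots \<pi>\<^sub>1 k @ slots \<pi>\<^sub>2 k)}"

lemma finite_set_scheme: "set_pmf P \<subseteq> detection_schemes n r \<Longrightarrow> finite (set_pmf P)"
  using finite_detection_schemes finite_subset by blast

lemma sum_schemes_eq_expectation:
  "set_pmf P \<subseteq> detection_schemes n r \<Longrightarrow>
    (\<Sum>\<pi>\<in>detection_schemes n r. f \<pi> * pmf P \<pi>) = measure_pmf.expectation P f"
  by (subst integral_measure_pmf_real[of "detection_schemes n r"])
    (auto simp: finite_detection_schemes)

lemma detection_prob_eq:
  assumes P: "set_pmf P \<subseteq> detection_schemes n r" and p: "\<And>i. i \<in> {1..n} \<Longrightarrow> p i \<in> {0..1}"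
  shows "detection_prob n r P p = 1 - escape_prob P r p"
proof -
  have "measure_pmf.prob (decisions_pmf n r p) {D. T_det r \<pi> D < \<infinity>} =
      1 - miss_prob p (slots \<pi> r)" if "\<pi> \<in> detection_schemes n r" for \<pi>
  proof -
    have "{D. T_det r \<pi> D < \<infinity>} = UNIV - {D. \<forall>t\<in>{1..r}. \<not> D (\<pi> t, t)}"
      by (simp only: T_det_finite_iff) auto
    then show ?thesis
      using prob_no_detection[OF that order.refl p] measure_pmf.prob_compl[of _ "decisions_pmf n r p"]
      by simp
  qed
  then have "detection_prob n r P p =
      (\<Sum>\<pi>\<in>detection_schemes n r. (1 - miss_prob p (slots \<pi> r)) * pmf P \<pi>)"
    unfolding detection_prob_def by (intro sum.cong) auto
  also have "\<dots> = measure_pmf.expectation P (\<lambda>\<pi>. 1 - miss_prob p (slots \<pi> r))"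
    by (rule sum_schemes_eq_expectation[OF P])
  also have "\<dots> = 1 - escape_prob P r p"
    unfolding escape_prob_def
    by (subst Bochner_Integration.integral_diff)
      (auto intro: integrable_measure_pmf_finite finite_set_scheme[OF P])
  finally show ?thesis .
qed

text \<open>
  The mean detection time counts only the runs that end with a detection; the subtracted term is the
  contribution of the others to the mean of \<open>min T_det r\<close>.
\<close>

lemma mean_detection_time_eq:
  assumes P: "set_pmf P \<subseteq> detection_schemes n r" and p: "\<And>i. i \<in> {1..n} \<Longrightarrow> p i \<in> {0..1}"
  shows "mean_detection_time n r P p = trunc_time P r p - r * escape_prob P r p"
proof -
  have int: "integrable P (f :: _ \<Rightarrow> real)" for f
    by (intro integrable_measure_pmf_finite finite_set_scheme[OF P])
  have "mean_detection_time n r P p = (\<Sum>\<pi>\<in>detection_schemes n r.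
      ((\<Sum>k<r. miss_prob p (slots \<pi> k)) - r * miss_prob p (slots \<pi> r)) * pmf P \<pi>)"
    unfolding mean_detection_time_def using expectation_T_det[OF _ p]
    by (intro sum.cong) auto
  also have "\<dots> = measure_pmf.expectation P
      (\<lambda>\<pi>. (\<Sum>k<r. miss_prob p (slots \<pi> k)) - r * miss_prob p (slots \<pi> r))"
    by (rule sum_schemes_eq_expectation[OF P])
  also have "\<dots> = trunc_time P r p - r * escape_prob P r p"
    unfolding trunc_time_def escape_prob_def
    by (subst Bochner_Integration.integral_diff) (use int in auto)
  finally show ?thesis .
qed

lemma expectation_pair_pmf_iterated:
  fixes f :: "'a \<times> 'b \<Rightarrow> real"
  assumes "finite (set_pmf P)" "finite (set_pmf Q)"
  shows "measure_pmf.expectation (pair_pmf P Q) f =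
    measure_pmf.expectation P (\<lambda>x. measure_pmf.expectation Q (\<lambda>y. f (x, y)))"
proof -
  have "measure_pmf.expectation (pair_pmf P Q) f =
      (\<Sum>z\<in>set_pmf P \<times> set_pmf Q. f z * pmf (pair_pmf P Q) z)"
    using assms by (intro integral_measure_pmf_real) auto
  also have "\<dots> = (\<Sum>x\<in>set_pmf P. (\<Sum>y\<in>set_pmf Q. f (x, y) * pmf Q y) * pmf P x)"
    by (simp add: sum.cartesian_product' pmf_pair sum_distrib_left mult_ac)
  also have "\<dots> = measure_pmf.expectation P (\<lambda>x. measure_pmf.expectation Q (\<lambda>y. f (x, y)))"
    using assms by (simp add: integral_measure_pmf_real[of "set_pmf P"]
        integral_measure_pmf_real[of "set_pmf Q"])
  finally show ?thesis .
qed

lemma expectation_swap: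
  fixes f :: "'a \<Rightarrow> 'b \<Rightarrow> real"
  assumes "finite (set_pmf P)" "finite (set_pmf Q)"
  shows "measure_pmf.expectation P (\<lambda>x. measure_pmf.expectation Q (f x)) =
    measure_pmf.expectation Q (\<lambda>y. measure_pmf.expectation P (\<lambda>x. f x y))"
proof -
  have "measure_pmf.expectation P (\<lambda>x. measure_pmf.expectation Q (f x)) =
      (\<Sum>x\<in>set_pmf P. \<Sum>y\<in>set_pmf Q. f x y * pmf Q y * pmf P x)"
    using assms by (simp add: integral_measure_pmf_real[of "set_pmf P"]
        integral_measure_pmf_real[of "set_pmf Q"] sum_distrib_right)
  also have "\<dots> = (\<Sum>y\<in>set_pmf Q. \<Sum>x\<in>set_pmf P. f x y * pmf P x * pmf Q y)"
    by (subst sum.swap) (simp add: mult_ac)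
  also have "\<dots> = measure_pmf.expectation Q (\<lambda>y. measure_pmf.expectation P (\<lambda>x. f x y))"
    using assms by (simp add: integral_measure_pmf_real[of "set_pmf P"]
        integral_measure_pmf_real[of "set_pmf Q"] sum_distrib_right)
  finally show ?thesis .
qed

text \<open>
  The event of \<open>repeat_prob\<close> is the union of a repetition in the first copy, one in the second copy, and
  a detector common to both.
\<close>

lemma distinct_prob_le_repeat: "1 - distinct_prob P k \<le> repeat_prob P k"
  and disjoint_prob_le_repeat: "1 - disjoint_prob P k \<le> repeat_prob P k"
  and repeat_prob_le: "repeat_prob P k \<le> 2 * (1 - distinct_prob P k) + (1 - disjoint_prob P k)"
proof -
  let ?M = "measure_pmf.prob (pair_pmf P P)"
  let ?E1 = "{z. \<not> distinct (slots (fst z) k)}" and ?E2 = "{z. \<not> distinct (slots (snd z) k)}"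
  let ?E3 = "{z. fst z ` {1..k} \<inter> snd z ` {1..k} \<noteq> {}}"
  have a: "1 - distinct_prob P k = measure_pmf.prob P {\<pi>. \<not> distinct (slots \<pi> k)}"
    using measure_pmf.prob_compl[of "{\<pi>. distinct (slots \<pi> k)}" P]
    unfolding distinct_prob_def distinct_slots_iff[symmetric]
    by (simp add: Compl_eq_Diff_UNIV[symmetric] Collect_neg_eq)
  have "measure_pmf.prob (map_pmf fst (pair_pmf P P)) {\<pi>. \<not> distinct (slots \<pi> k)} = ?M ?E1"
    unfolding measure_map_pmf by (simp add: vimage_def)
  then have E1: "?M ?E1 = 1 - distinct_prob P k"
    by (simp add: a map_fst_pair_pmf)
  have "measure_pmf.prob (map_pmf snd (pair_pmf P P)) {\<pi>. \<not> distinct (slots \<pi> k)} = ?M ?E2"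
    unfolding measure_map_pmf by (simp add: vimage_def)
  then have E2: "?M ?E2 = 1 - distinct_prob P k"
    by (simp add: a map_snd_pair_pmf)
  have E3: "?M ?E3 = 1 - disjoint_prob P k"
    using measure_pmf.prob_compl[of "- ?E3" "pair_pmf P P"]
    by (simp add: disjoint_prob_def case_prod_beta' Compl_eq_Diff_UNIV[symmetric]
        Collect_neg_eq[symmetric])
  have R: "repeat_prob P k = ?M (?E1 \<union> ?E2 \<union> ?E3)"
    unfolding repeat_prob_def
    by (intro arg_cong[where f = ?M]) (auto simp: set_slots)
  show "1 - distinct_prob P k \<le> repeat_prob P k"
    unfolding R E1[symmetric] by (rule measure_pmf.finite_measure_mono) auto
  show "1 - disjoint_prob P k \<le> repeat_prob P k"
    unfolding R E3[symmetric] by (rule measure_pmf.finite_measure_mono) auto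
  have "?M (?E1 \<union> ?E2 \<union> ?E3) \<le> ?M (?E1 \<union> ?E2) + ?M ?E3"
    by (rule measure_Un_le) auto
  moreover have "?M (?E1 \<union> ?E2) \<le> ?M ?E1 + ?M ?E2"
    by (rule measure_Un_le) auto
  ultimately show "repeat_prob P k \<le> 2 * (1 - distinct_prob P k) + (1 - disjoint_prob P k)"
    unfolding R E1 E2 E3 by simp
qed

lemma repeat_prob_tendsto_0_iff:
  "(\<forall>k\<ge>1. (\<lambda>n. repeat_prob (P n) k) \<longlonglongrightarrow> 0) \<longleftrightarrow>
    (\<forall>k\<ge>1. (\<lambda>n. distinct_prob (P n) k) \<longlonglongrightarrow> 1) \<and>
    (\<forall>k\<ge>1. (\<lambda>n. disjoint_prob (P n) k) \<longlonglongrightarrow> 1)"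
proof -
  have "(\<lambda>n. repeat_prob (P n) k) \<longlonglongrightarrow> 0 \<longleftrightarrow>
      (\<lambda>n. distinct_prob (P n) k) \<longlonglongrightarrow> 1 \<and> (\<lambda>n. disjoint_prob (P n) k) \<longlonglongrightarrow> 1" for k
  proof (intro iffI conjI)
    assume r: "(\<lambda>n. repeat_prob (P n) k) \<longlonglongrightarrow> 0"
    have r': "(\<lambda>n. 1 - repeat_prob (P n) k) \<longlonglongrightarrow> 1" using tendsto_diff[OF tendsto_const r] by simp
    show "(\<lambda>n. distinct_prob (P n) k) \<longlonglongrightarrow> 1"
    proof (rule tendsto_sandwich[OF _ _ r' tendsto_const])
      show "\<forall>\<^sub>F n in sequentially. 1 - repeat_prob (P n) k \<le> distinct_prob (P n) k"
        using distinct_prob_le_repeat by (simp add: algebra_simps)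
    qed (simp add: distinct_prob_def)
    show "(\<lambda>n. disjoint_prob (P n) k) \<longlonglongrightarrow> 1"
    proof (rule tendsto_sandwich[OF _ _ r' tendsto_const])
      show "\<forall>\<^sub>F n in sequentially. 1 - repeat_prob (P n) k \<le> disjoint_prob (P n) k"
        using disjoint_prob_le_repeat by (simp add: algebra_simps)
    qed (simp add: disjoint_prob_def)
  next
    assume "(\<lambda>n. distinct_prob (P n) k) \<longlonglongrightarrow> 1 \<and> (\<lambda>n. disjoint_prob (P n) k) \<longlonglongrightarrow> 1"
    then have lim: "(\<lambda>n. 2 * (1 - distinct_prob (P n) k) + (1 - disjoint_prob (P n) k))
        \<longlonglongrightarrow> 2 * (1 - 1) + (1 - 1)"
      by (intro tendsto_intros) auto
    then have lim': "(\<lambda>n. 2 * (1 - distinct_prob (P n) k) + (1 - disjoint_prob (P n) k)) \<longlonglongrightarrow> 0"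
      by simp
    show "(\<lambda>n. repeat_prob (P n) k) \<longlonglongrightarrow> 0"
      by (rule tendsto_sandwich[OF _ _ tendsto_const lim'])
        (simp add: repeat_prob_def, intro always_eventually allI repeat_prob_le)
  qed
  then show ?thesis by blast
qed

section \<open>First and second moments of the truncated detection time\<close>

lemma geometric_tail_le:
  fixes x :: real
  assumes "0 < x" "x < 1"
  shows "(\<Sum>k\<in>{K..<r}. x ^ k) \<le> x ^ K / (1 - x)"
proof (cases "K \<le> r")
  case True
  then have "(\<Sum>k\<in>{K..<r}. x ^ k) * (1 - x) = x ^ K - x ^ r"
  proof (induction rule: dec_induct)
    case (step m)
    then show ?case by (simp add: distrib_right) (simp add: algebra_simps)
  qed simp
  also have "\<dots> \<le> x ^ K" using assms by simp
  finally show ?thesis using assms by (simp add: field_simps)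
qed (use assms in simp)

lemma set_slots_pair_subset:
  assumes "z \<in> set_pmf (pair_pmf P P)" "set_pmf P \<subseteq> detection_schemes n r" "j \<le> r" "k \<le> r"
  shows "set (slots (fst z) j @ slots (snd z) k) \<subseteq> {1..n}"
proof -
  have "fst z \<in> detection_schemes n r" "snd z \<in> detection_schemes n r" using assms(1,2) by auto
  then show ?thesis using set_slots_subset assms(3,4) by (metis set_append Un_least)
qed

context detector_probabilities
begin

lemma conf_in_01: "p \<in> set_pmf (conf_pmf \<Omega> n) \<Longrightarrow> i \<in> {1..n} \<Longrightarrow> p i \<in> {0..1}"
  using conf_in_\<Omega>[of p n i] \<Omega>_subset by force

lemma miss_prob_bounds:
  assumes p: "p \<in> set_pmf (conf_pmf \<Omega> n)" and xs: "set xs \<subseteq> {1..n}"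
  shows "0 \<le> miss_prob p xs" "miss_prob p xs \<le> q_max ^ length xs"
proof -
  have "0 \<le> miss_prob p xs \<and> miss_prob p xs \<le> q_max ^ length xs"
    using xs
  proof (induction xs)
    case (Cons x xs)
    have "p x \<in> \<Omega>" using conf_in_\<Omega>[OF p] Cons.prems by auto
    then have "0 \<le> 1 - p x" "1 - p x \<le> q_max" using q_max_ge \<Omega>_subset by auto
    then show ?case using Cons q_max_pos by (auto simp: miss_prob_def intro!: mult_mono)
  qed (simp add: miss_prob_def)
  then show "0 \<le> miss_prob p xs" "miss_prob p xs \<le> q_max ^ length xs" by auto
qed

lemma mean_miss_le_1: "set xs \<subseteq> {1..n} \<Longrightarrow> mean_miss n xs \<le> 1"
  unfolding mean_miss_def
proof (rule measure_pmf.integral_le_const[OF integrable_conf_pmf], rule AE_pmfI)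
  fix p assume p: "p \<in> set_pmf (conf_pmf \<Omega> n)" and "set xs \<subseteq> {1..n}"
  then have "miss_prob p xs \<le> q_max ^ length xs" by (rule miss_prob_bounds)
  also have "\<dots> \<le> 1" using q_max_pos q_max_less_1 by (intro power_le_one) auto
  finally show "miss_prob p xs \<le> 1" .
qed

lemma miss_slots_bounds:
  assumes "p \<in> set_pmf (conf_pmf \<Omega> n)" "set_pmf P \<subseteq> detection_schemes n r"
    and "\<pi> \<in> set_pmf P" "k \<le> r"
  shows "0 \<le> miss_prob p (slots \<pi> k)" "miss_prob p (slots \<pi> k) \<le> q_max ^ k"
  using miss_prob_bounds[OF assms(1) set_slots_subset[of \<pi> n r k]] assms by auto

lemma escape_prob_bounds:
  assumes p: "p \<in> set_pmf (conf_pmf \<Omega> n)" and P: "set_pmf P \<subseteq> detection_schemes n r"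
  shows "0 \<le> escape_prob P r p" "escape_prob P r p \<le> q_max ^ r"
  unfolding escape_prob_def
  using miss_slots_bounds[OF p P]
  by (auto intro!: integral_nonneg_AE measure_pmf.integral_le_const AE_pmfI
      integrable_measure_pmf_finite finite_set_scheme[OF P])

lemma trunc_time_nonneg:
  assumes p: "p \<in> set_pmf (conf_pmf \<Omega> n)" and P: "set_pmf P \<subseteq> detection_schemes n r" and K: "K \<le> r"
  shows "0 \<le> trunc_time P K p"
  unfolding trunc_time_def
  using miss_slots_bounds(1)[OF p P] K
  by (intro integral_nonneg_AE AE_pmfI sum_nonneg) auto

lemma trunc_time_mono:
  assumes p: "p \<in> set_pmf (conf_pmf \<Omega> n)" and P: "set_pmf P \<subseteq> detection_schemes n r" and K: "K \<le> r"
  shows "trunc_time P K p \<le> trunc_time P r p"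
  unfolding trunc_time_def
  using miss_slots_bounds(1)[OF p P] K
  by (intro integral_mono_AE AE_pmfI sum_mono2 integrable_measure_pmf_finite finite_set_scheme[OF P])
    auto

text \<open>
  The truncation at a fixed \<open>K\<close> is harmless uniformly in the number of slots, because each slot fails
  with probability at most \<open>q_max < 1\<close>.
\<close>

lemma trunc_time_tail:
  assumes p: "p \<in> set_pmf (conf_pmf \<Omega> n)" and P: "set_pmf P \<subseteq> detection_schemes n r" and K: "K \<le> r"
  shows "trunc_time P r p \<le> trunc_time P K p + q_max ^ K / (1 - q_max)"
proof -
  have int: "integrable P (f :: _ \<Rightarrow> real)" for f
    by (intro integrable_measure_pmf_finite finite_set_scheme[OF P])
  have "trunc_time P r p \<le> measure_pmf.expectation P
      (\<lambda>\<pi>. (\<Sum>k<K. miss_prob p (slots \<pi> k)) + q_max ^ K / (1 - q_max))"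
    unfolding trunc_time_def
  proof (rule integral_mono_AE[OF int int], rule AE_pmfI)
    fix \<pi> assume \<pi>: "\<pi> \<in> set_pmf P"
    have "(\<Sum>k\<in>{K..<r}. miss_prob p (slots \<pi> k)) \<le> (\<Sum>k\<in>{K..<r}. q_max ^ k)"
      using miss_slots_bounds(2)[OF p P \<pi>] by (intro sum_mono) auto
    also have "\<dots> \<le> q_max ^ K / (1 - q_max)"
      by (rule geometric_tail_le[OF q_max_pos q_max_less_1])
    finally show "(\<Sum>k<r. miss_prob p (slots \<pi> k)) \<le>
        (\<Sum>k<K. miss_prob p (slots \<pi> k)) + q_max ^ K / (1 - q_max)"
      using sum.atLeastLessThan_concat[OF _ K, of 0 "\<lambda>k. miss_prob p (slots \<pi> k)"]
      by (simp add: atLeast0LessThan)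
  qed
  also have "\<dots> = trunc_time P K p + q_max ^ K / (1 - q_max)"
    unfolding trunc_time_def by (subst Bochner_Integration.integral_add) (use int in auto)
  finally show ?thesis .
qed

lemma trunc_time_le:
  assumes "p \<in> set_pmf (conf_pmf \<Omega> n)" "set_pmf P \<subseteq> detection_schemes n r"
  shows "trunc_time P r p \<le> 1 / (1 - q_max)"
  using trunc_time_tail[OF assms, of 0] by (simp add: trunc_time_def)

text \<open>
  The configuration average of the truncated time of a scheme that never reuses a detector.
\<close>

definition ideal_time :: "nat \<Rightarrow> real" where
  "ideal_time K = (\<Sum>k<K. q_av ^ k)"

lemma ideal_time_nonneg: "0 \<le> ideal_time K"
  unfolding ideal_time_def using q_av_pos by (intro sum_nonneg) auto

lemma ideal_time_tendsto: "ideal_time \<longlonglongrightarrow> 1 / (1 - q_av)"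
  using geometric_sums[of q_av] q_av_pos q_av_less_1 by (simp add: sums_def ideal_time_def[abs_def])

lemma ideal_time_le: "ideal_time K \<le> 1 / (1 - q_av)"
  using geometric_tail_le[OF q_av_pos q_av_less_1, of 0 K] by (simp add: ideal_time_def atLeast0LessThan)

lemma ideal_time_square: "(ideal_time K)\<^sup>2 = (\<Sum>j<K. \<Sum>k<K. q_av ^ (j + k))"
  by (simp add: ideal_time_def power2_eq_square sum_product power_add)

lemma mean_trunc_time_lower:
  assumes P: "set_pmf P \<subseteq> detection_schemes n r" and K: "K \<le> r"
  shows "ideal_time K \<le> measure_pmf.expectation (conf_pmf \<Omega> n) (trunc_time P K)"
proof -
  have "measure_pmf.expectation (conf_pmf \<Omega> n) (trunc_time P K) =
      measure_pmf.expectation P (\<lambda>\<pi>. measure_pmf.expectation (conf_pmf \<Omega> n)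
        (\<lambda>p. \<Sum>k<K. miss_prob p (slots \<pi> k)))"
    unfolding trunc_time_def
    by (rule expectation_swap[OF finite_set_conf_pmf finite_set_scheme[OF P]])
  also have "\<dots> = measure_pmf.expectation P (\<lambda>\<pi>. \<Sum>k<K. mean_miss n (slots \<pi> k))"
    by (simp add: mean_miss_def integrable_conf_pmf)
  also have "\<dots> \<ge> ideal_time K"
  proof (rule measure_pmf.integral_ge_const, rule integrable_measure_pmf_finite[OF finite_set_scheme[OF P]],
      rule AE_pmfI)
    fix \<pi> assume \<pi>: "\<pi> \<in> set_pmf P"
    have "q_av ^ k \<le> mean_miss n (slots \<pi> k)" if "k < K" for k
      using mean_miss_ge_power[OF set_slots_subset[of \<pi> n r k]] \<pi> that P K by auto
    then show "ideal_time K \<le> (\<Sum>k<K. mean_miss n (slots \<pi> k))"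
      unfolding ideal_time_def by (intro sum_mono) auto
  qed
  finally show ?thesis .
qed

definition second_moment :: "nat \<Rightarrow> (nat \<Rightarrow> nat) pmf \<Rightarrow> nat \<Rightarrow> real" where
  "second_moment n P K = measure_pmf.expectation (conf_pmf \<Omega> n) (\<lambda>p. (trunc_time P K p)\<^sup>2)"

text \<open>
  The square of an average over schemes is an average over two independent copies, and the product of
  two miss probabilities is the miss probability of the concatenated list.
\<close>

lemma second_moment_eq:
  assumes P: "set_pmf P \<subseteq> detection_schemes n r"
  shows "second_moment n P K = measure_pmf.expectation (pair_pmf P P)
    (\<lambda>z. \<Sum>j<K. \<Sum>k<K. mean_miss n (slots (fst z) j @ slots (snd z) k))"
proof -
  note fin = finite_set_scheme[OF P]
  have "(trunc_time P K p)\<^sup>2 = measure_pmf.expectation (pair_pmf P P)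
      (\<lambda>z. \<Sum>j<K. \<Sum>k<K. miss_prob p (slots (fst z) j @ slots (snd z) k))" for p
    unfolding trunc_time_def
    by (simp add: expectation_pair_pmf_iterated[OF fin fin] miss_prob_append sum_product[symmetric]
        power2_eq_square)
  then have "second_moment n P K = measure_pmf.expectation (conf_pmf \<Omega> n)
      (\<lambda>p. measure_pmf.expectation (pair_pmf P P)
        (\<lambda>z. \<Sum>j<K. \<Sum>k<K. miss_prob p (slots (fst z) j @ slots (snd z) k)))"
    by (simp add: second_moment_def)
  also have "\<dots> = measure_pmf.expectation (pair_pmf P P)
      (\<lambda>z. measure_pmf.expectation (conf_pmf \<Omega> n)
        (\<lambda>p. \<Sum>j<K. \<Sum>k<K. miss_prob p (slots (fst z) j @ slots (snd z) k)))"
    using fin by (intro expectation_swap finite_set_conf_pmf) auto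
  also have "\<dots> = measure_pmf.expectation (pair_pmf P P)
      (\<lambda>z. \<Sum>j<K. \<Sum>k<K. mean_miss n (slots (fst z) j @ slots (snd z) k))"
    by (simp add: mean_miss_def integrable_conf_pmf)
  finally show ?thesis .
qed

lemma repeat_prob_expectation:
  "repeat_prob P k = measure_pmf.expectation (pair_pmf P P)
    (\<lambda>z. of_bool (\<not> distinct (slots (fst z) k @ slots (snd z) k)))"
proof -
  have "(\<lambda>z. of_bool (\<not> distinct (slots (fst z) k @ slots (snd z) k)) :: real) =
      indicator {(\<pi>\<^sub>1, \<pi>\<^sub>2). \<not> distinct (slots \<pi>\<^sub>1 k @ slots \<pi>\<^sub>2 k)}"
    by (auto simp: fun_eq_iff indicator_def)
  then show ?thesis by (simp add: repeat_prob_def)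
qed

text \<open>
  Without a repetition among the first \<open>K\<close> slots of both copies, all \<open>K\<^sup>2\<close> concatenated prefixes are
  distinct lists and have exactly the ideal mean; otherwise each mean is at most 1.
\<close>

lemma second_moment_upper:
  assumes P: "set_pmf P \<subseteq> detection_schemes n r" and K: "K \<le> r"
  shows "second_moment n P K \<le> (ideal_time K)\<^sup>2 + (real K)\<^sup>2 * repeat_prob P K"
proof -
  let ?rep = "\<lambda>z. of_bool (\<not> distinct (slots (fst z) K @ slots (snd z) K)) :: real"
  have int: "integrable (pair_pmf P P) (f :: _ \<Rightarrow> real)" for f
    using finite_set_scheme[OF P] by (intro integrable_measure_pmf_finite) auto
  have "second_moment n P K \<le> measure_pmf.expectation (pair_pmf P P)
      (\<lambda>z. (ideal_time K)\<^sup>2 + (real K)\<^sup>2 * ?rep z)"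
    unfolding second_moment_eq[OF P]
  proof (rule integral_mono_AE[OF int int], rule AE_pmfI)
    fix z assume z: "z \<in> set_pmf (pair_pmf P P)"
    have "mean_miss n (slots (fst z) j @ slots (snd z) k) \<le> q_av ^ (j + k) + ?rep z"
      if jk: "j < K" "k < K" for j k
    proof -
      have sub: "set (slots (fst z) j @ slots (snd z) k) \<subseteq> {1..n}"
        using jk K by (intro set_slots_pair_subset[OF z P]) auto
      show ?thesis
      proof (cases "distinct (slots (fst z) K @ slots (snd z) K)")
        case True
        have "slots (fst z) j = take j (slots (fst z) K)" "slots (snd z) k = take k (slots (snd z) K)"
          using jk by (auto simp: take_slots)
        then have "distinct (slots (fst z) j @ slots (snd z) k)"
          using True by (auto dest!: in_set_takeD)
        then show ?thesis using mean_miss_distinct[OF _ sub] True by simp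
      next
        case False
        have "0 \<le> q_av ^ (j + k)" using q_av_pos by simp
        then show ?thesis using mean_miss_le_1[OF sub] False by simp
      qed
    qed
    then have "(\<Sum>j<K. \<Sum>k<K. mean_miss n (slots (fst z) j @ slots (snd z) k)) \<le>
        (\<Sum>j<K. \<Sum>k<K. q_av ^ (j + k) + ?rep z)"
      by (intro sum_mono) auto
    also have "\<dots> = (ideal_time K)\<^sup>2 + (real K)\<^sup>2 * ?rep z"
      unfolding ideal_time_square by (simp add: sum.distrib power2_eq_square)
    finally show "(\<Sum>j<K. \<Sum>k<K. mean_miss n (slots (fst z) j @ slots (snd z) k)) \<le>
        (ideal_time K)\<^sup>2 + (real K)\<^sup>2 * ?rep z" .
  qed
  also have "\<dots> = (ideal_time K)\<^sup>2 + (real K)\<^sup>2 * repeat_prob P K"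
    unfolding repeat_prob_expectation
    by (subst Bochner_Integration.integral_add) (use int in auto)
  finally show ?thesis .
qed

text \<open>
  All \<open>K\<^sup>2\<close> terms are at least their ideal values, and the surplus of the single term with both
  prefixes of length \<open>k\<close> is kept.
\<close>

lemma second_moment_lower:
  assumes P: "set_pmf P \<subseteq> detection_schemes n r" and k: "k < K" and K: "K \<le> r"
  shows "(ideal_time K)\<^sup>2 + q_var * q_min ^ (2 * k) * repeat_prob P k \<le> second_moment n P K"
proof -
  let ?rep = "\<lambda>z. of_bool (\<not> distinct (slots (fst z) k @ slots (snd z) k)) :: real"
  define c where "c = q_var * q_min ^ (2 * k)"
  have int: "integrable (pair_pmf P P) (f :: _ \<Rightarrow> real)" for f
    using finite_set_scheme[OF P] by (intro integrable_measure_pmf_finite) auto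
  have "(ideal_time K)\<^sup>2 + c * repeat_prob P k =
      measure_pmf.expectation (pair_pmf P P) (\<lambda>z. (ideal_time K)\<^sup>2 + c * ?rep z)"
    unfolding repeat_prob_expectation
    by (subst Bochner_Integration.integral_add) (use int in auto)
  also have "\<dots> \<le> second_moment n P K"
    unfolding second_moment_eq[OF P]
  proof (rule integral_mono_AE[OF int int], rule AE_pmfI)
    fix z assume z: "z \<in> set_pmf (pair_pmf P P)"
    define m where "m = (\<lambda>i j. mean_miss n (slots (fst z) i @ slots (snd z) j) - q_av ^ (i + j))"
    have lower: "of_bool (\<not> distinct (slots (fst z) i @ slots (snd z) j)) *
        (q_var * q_min ^ (i + j)) \<le> m i j" if "i < K" "j < K" for i j
    proof -
      have sub: "set (slots (fst z) i @ slots (snd z) j) \<subseteq> {1..n}"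
        using that K by (intro set_slots_pair_subset[OF z P]) auto
      show ?thesis using mean_miss_lower[OF sub] by (simp add: m_def)
    qed
    have nonneg: "0 \<le> m i j" if "i < K" "j < K" for i j
      by (rule order_trans[OF _ lower[OF that]]) (use q_var_nonneg q_min_pos in auto)
    have "c * ?rep z \<le> m k k"
      using lower[OF k k] unfolding c_def mult_2 by (subst mult.commute)
    also have "\<dots> \<le> (\<Sum>j<K. m k j)"
      using nonneg k by (intro member_le_sum) auto
    also have "\<dots> \<le> (\<Sum>i<K. \<Sum>j<K. m i j)"
      using nonneg k by (intro member_le_sum[of k "{..<K}" "\<lambda>i. \<Sum>j<K. m i j"] sum_nonneg) auto
    also have "\<dots> = (\<Sum>i<K. \<Sum>j<K. mean_miss n (slots (fst z) i @ slots (snd z) j)) - (ideal_time K)\<^sup>2"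
      by (simp add: m_def ideal_time_square sum_subtractf)
    finally show "(ideal_time K)\<^sup>2 + c * ?rep z \<le>
        (\<Sum>i<K. \<Sum>j<K. mean_miss n (slots (fst z) i @ slots (snd z) j))" by simp
  qed
  finally show ?thesis by (simp add: c_def)
qed

section \<open>Converse: a small detection time forces a small second moment\<close>

text \<open>
  On the event of the achievability condition the truncated time is below
  \<open>s + \<delta> + r * q_max ^ r\<close>; its complement has probability below \<open>\<epsilon>\<close>, and there the geometric bound
  \<open>1 / (1 - q_max)\<close> applies.
\<close>

lemma second_moment_of_achievability_condition:
  assumes P: "set_pmf P \<subseteq> detection_schemes n r" and K: "K \<le> r"
    and s: "0 < s" "0 < \<delta>"
    and cond: "achievability_condition \<Omega> n r P s \<epsilon> \<delta>"
  shows "second_moment n P K \<le> (s + \<delta> + r * q_max ^ r)\<^sup>2 + \<epsilon> * (1 / (1 - q_max))\<^sup>2"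
proof -
  define G where "G = {p. detection_prob n r P p > 1 - \<epsilon> \<and> mean_detection_time n r P p < s + \<delta>}"
  define b M where "b = s + \<delta> + r * q_max ^ r" and "M = 1 / (1 - q_max)"
  have b: "0 \<le> b" using s q_max_pos by (simp add: b_def)
  have G: "1 - \<epsilon> < measure_pmf.prob (conf_pmf \<Omega> n) G"
    using cond by (simp add: achievability_condition_def G_def)
  have "second_moment n P K \<le> measure_pmf.expectation (conf_pmf \<Omega> n) (\<lambda>p. b\<^sup>2 + M\<^sup>2 * indicator (- G) p)"
    unfolding second_moment_def
  proof (rule integral_mono_AE[OF integrable_conf_pmf integrable_conf_pmf], rule AE_pmfI)
    fix p assume p: "p \<in> set_pmf (conf_pmf \<Omega> n)"
    note bounds = trunc_time_nonneg[OF p P K] trunc_time_mono[OF p P K] trunc_time_le[OF p P]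
    show "(trunc_time P K p)\<^sup>2 \<le> b\<^sup>2 + M\<^sup>2 * indicator (- G) p"
    proof (cases "p \<in> G")
      case True
      have "trunc_time P r p = mean_detection_time n r P p + r * escape_prob P r p"
        using mean_detection_time_eq[OF P, of p] conf_in_01[OF p] by simp
      also have "\<dots> \<le> s + \<delta> + r * q_max ^ r"
        using True escape_prob_bounds(2)[OF p P]
        by (intro add_mono mult_left_mono) (auto simp: G_def)
      finally have "trunc_time P K p \<le> b" using bounds by (simp add: b_def)
      then show ?thesis using True bounds by (simp add: power_mono)
    next
      case False
      have "trunc_time P K p \<le> M" using bounds by (simp add: M_def)
      then have "(trunc_time P K p)\<^sup>2 \<le> M\<^sup>2" using bounds by (simp add: power_mono)
      then show ?thesis using False by (simp add: add_increasing)
    qed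
  qed
  also have "\<dots> = b\<^sup>2 + M\<^sup>2 * measure_pmf.prob (conf_pmf \<Omega> n) (- G)"
    by (subst Bochner_Integration.integral_add) (use integrable_conf_pmf in auto)
  also have "\<dots> \<le> b\<^sup>2 + M\<^sup>2 * \<epsilon>"
    using G measure_pmf.prob_compl[of G "conf_pmf \<Omega> n"]
    by (intro add_left_mono mult_left_mono) (auto simp: Compl_eq_Diff_UNIV)
  finally show ?thesis by (simp add: b_def M_def mult_ac)
qed

lemma random_scheme_subset:
  "random_scheme r P \<Longrightarrow> n \<ge> 1 \<Longrightarrow> set_pmf (P n) \<subseteq> detection_schemes n (r n)"
  by (simp add: random_scheme_def)

lemma random_scheme_eventually_ge:
  "random_scheme r P \<Longrightarrow> \<forall>\<^sub>F n in sequentially. K \<le> r n"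
  by (simp add: random_scheme_def filterlim_at_top)

lemma eventually_second_moment_le:
  assumes rs: "random_scheme r P" and s: "0 < s" "0 < \<delta>"
    and cond: "\<forall>\<^sub>F n in sequentially. achievability_condition \<Omega> n (r n) (P n) s \<epsilon> \<delta>"
  shows "\<forall>\<^sub>F n in sequentially.
    second_moment n (P n) K \<le> (s + 2 * \<delta>)\<^sup>2 + \<epsilon> * (1 / (1 - q_max))\<^sup>2"
proof -
  have "(\<lambda>m. real m * q_max ^ m) \<longlonglongrightarrow> 0"
    using q_max_pos q_max_less_1 by (intro powser_times_n_limit_0) auto
  then have "(\<lambda>n. real (r n) * q_max ^ r n) \<longlonglongrightarrow> 0"
    using rs by (auto simp: random_scheme_def intro: filterlim_compose)
  then have "\<forall>\<^sub>F n in sequentially. real (r n) * q_max ^ r n < \<delta>"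
    using s(2) by (rule order_tendstoD)
  with cond random_scheme_eventually_ge[OF rs, of K] eventually_ge_at_top[of 1]
  show ?thesis
  proof eventually_elim
    case (elim n)
    have "second_moment n (P n) K \<le>
        (s + \<delta> + r n * q_max ^ r n)\<^sup>2 + \<epsilon> * (1 / (1 - q_max))\<^sup>2"
      using elim s by (intro second_moment_of_achievability_condition random_scheme_subset[OF rs]) auto
    moreover have "(s + \<delta> + r n * q_max ^ r n)\<^sup>2 \<le> (s + 2 * \<delta>)\<^sup>2"
      using elim s q_max_pos by (intro power_mono) auto
    ultimately show ?case by linarith
  qed
qed

lemma tolerances_exist:
  fixes s \<eta> M :: real
  assumes "0 < s" "0 < \<eta>" "0 < M"
  obtains \<epsilon> \<delta> where "0 < \<epsilon>" "0 < \<delta>" "(s + 2 * \<delta>)\<^sup>2 + \<epsilon> * M\<^sup>2 \<le> s\<^sup>2 + \<eta>"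
proof -
  define \<delta> where "\<delta> = min 1 (\<eta> / (8 * (s + 1)))"
  have \<delta>: "0 < \<delta>" using assms by (simp add: \<delta>_def)
  have \<epsilon>: "0 < \<eta> / 2 / M\<^sup>2" using assms by simp
  \<comment> \<open>Expanding the square adds \<open>4 * s * \<delta> + 4 * \<delta>\<^sup>2\<close>, at most \<open>4 * \<delta> * (s + 1)\<close> since \<open>\<delta> \<le> 1\<close>.\<close>
  have "\<delta> * (8 * (s + 1)) \<le> \<eta>"
  proof -
    have "\<delta> * (8 * (s + 1)) \<le> \<eta> / (8 * (s + 1)) * (8 * (s + 1))"
      using assms by (intro mult_right_mono) (auto simp: \<delta>_def)
    then show ?thesis using assms by simp
  qed
  moreover have "\<delta> * \<delta> \<le> \<delta> * 1"
    using \<delta> by (intro mult_left_mono) (auto simp: \<delta>_def)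
  ultimately have "(s + 2 * \<delta>)\<^sup>2 + \<eta> / 2 / M\<^sup>2 * M\<^sup>2 \<le> s\<^sup>2 + \<eta>"
    using assms by (simp add: power2_eq_square algebra_simps)
  then show thesis by (rule that[OF \<epsilon> \<delta>])
qed

lemma ideal_time_le_second_moment:
  assumes "set_pmf P \<subseteq> detection_schemes n r" "K \<le> r"
  shows "(ideal_time K)\<^sup>2 \<le> second_moment n P K"
proof (cases K)
  case 0
  then show ?thesis by (simp add: ideal_time_def second_moment_def trunc_time_def)
next
  case (Suc k)
  have "0 \<le> q_var * q_min ^ (2 * k) * repeat_prob P k"
    using q_var_nonneg q_min_pos by (simp add: repeat_prob_def)
  then show ?thesis using second_moment_lower[OF assms(1) _ assms(2), of k] Suc by simp
qed

text \<open>
  The second moment of the truncated time is caught between \<open>(ideal_time K)\<^sup>2\<close> and \<open>s\<^sup>2 + \<eta>\<close>.  The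
  schemes depend on the tolerances \<open>\<epsilon>\<close> and \<open>\<delta>\<close>, but \<open>K\<close> and \<open>s\<close> do not, so \<open>\<eta> \<rightarrow> 0\<close> and then \<open>K \<rightarrow> \<infinity>\<close> give
  the bound.
\<close>

lemma achievable_ge:
  assumes "achievable \<Omega> s"
  shows "1 / (1 - q_av) \<le> s"
proof -
  have s: "0 < s" using assms by (simp add: achievable_def)
  have "ideal_time K \<le> s" for K
  proof -
    have "(ideal_time K)\<^sup>2 \<le> s\<^sup>2"
    proof (rule field_le_epsilon)
      fix \<eta> :: real assume \<eta>: "0 < \<eta>"
      have M: "0 < 1 / (1 - q_max)" using q_max_less_1 by simp
      obtain \<epsilon> \<delta> where ed: "0 < \<epsilon>" "0 < \<delta>"
        and le: "(s + 2 * \<delta>)\<^sup>2 + \<epsilon> * (1 / (1 - q_max))\<^sup>2 \<le> s\<^sup>2 + \<eta>"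
        using tolerances_exist[OF s \<eta> M] by blast
      obtain N r P where rs: "random_scheme r P"
        and N: "\<forall>n\<ge>N. achievability_condition \<Omega> n (r n) (P n) s \<epsilon> \<delta>"
        using assms ed unfolding achievable_def by blast
      from N have "\<forall>\<^sub>F n in sequentially. achievability_condition \<Omega> n (r n) (P n) s \<epsilon> \<delta>"
        unfolding eventually_sequentially by blast
      from eventually_second_moment_le[OF rs s ed(2) this, of K]
        random_scheme_eventually_ge[OF rs, of K] eventually_ge_at_top[of 1]
      have "\<forall>\<^sub>F n :: nat in sequentially. (ideal_time K)\<^sup>2 \<le> s\<^sup>2 + \<eta>"
      proof eventually_elim
        case (elim n)
        have "(ideal_time K)\<^sup>2 \<le> second_moment n (P n) K"
          using ideal_time_le_second_moment[OF random_scheme_subset[OF rs]] elim by blast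
        then show ?case using elim le by linarith
      qed
      then show "(ideal_time K)\<^sup>2 \<le> s\<^sup>2 + \<eta>" by simp
    qed
    then show ?thesis by (rule power2_le_imp_le) (use s in simp)
  qed
  then show ?thesis
    by (intro LIMSEQ_le_const2[OF ideal_time_tendsto] exI allI impI)
qed

text \<open>
  Now both ends of the chain for the second moment are close to the same square, and the surplus
  caused by repetitions has to fit in between; the variance in front of it is positive because \<open>\<Omega>\<close>
  has two points.
\<close>

lemma repeat_prob_tendsto_0_of_achieved:
  assumes card: "card \<Omega> \<ge> 2" and ach: "achieved_by \<Omega> r P (1 / (1 - q_av))"
  shows "(\<lambda>n. repeat_prob (P n) k) \<longlonglongrightarrow> 0"
proof (rule order_tendstoI)
  fix a :: real assume "a < 0"
  then have "a < repeat_prob (P n) k" for n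
    by (rule less_le_trans) (simp add: repeat_prob_def)
  then show "\<forall>\<^sub>F n in sequentially. a < repeat_prob (P n) k" by simp
next
  fix e :: real assume e: "0 < e"
  define s where "s = 1 / (1 - q_av)"
  define c where "c = q_var * q_min ^ (2 * k)"
  have c: "0 < c" using q_var_pos[OF card] q_min_pos by (simp add: c_def)
  have s: "0 < s" using q_av_less_1 by (simp add: s_def)
  have rs: "random_scheme r P" using ach by (simp add: achieved_by_def)
  have ce: "0 < c * e / 2" using c e by simp
  have "(\<lambda>K. (ideal_time K)\<^sup>2) \<longlonglongrightarrow> s\<^sup>2"
    unfolding s_def by (intro tendsto_intros ideal_time_tendsto)
  then have "\<forall>\<^sub>F K in sequentially. s\<^sup>2 - c * e / 2 < (ideal_time K)\<^sup>2"
    using ce by (intro order_tendstoD(1)[of _ "s\<^sup>2"]) auto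
  then have "\<forall>\<^sub>F K in sequentially. s\<^sup>2 - c * e / 2 < (ideal_time K)\<^sup>2 \<and> k < K"
    using eventually_gt_at_top[of k] by eventually_elim simp
  then obtain K where K: "s\<^sup>2 - c * e / 2 < (ideal_time K)\<^sup>2" "k < K"
    unfolding eventually_sequentially by blast
  have M: "0 < 1 / (1 - q_max)" using q_max_less_1 by simp
  obtain \<epsilon> \<delta> where ed: "0 < \<epsilon>" "0 < \<delta>"
    and le: "(s + 2 * \<delta>)\<^sup>2 + \<epsilon> * (1 / (1 - q_max))\<^sup>2 \<le> s\<^sup>2 + c * e / 2"
    using tolerances_exist[OF s ce M] by blast
  have "\<forall>\<^sub>F n in sequentially. achievability_condition \<Omega> n (r n) (P n) s \<epsilon> \<delta>"
    using ach ed unfolding achieved_by_def eventually_sequentially s_def by blast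
  from eventually_second_moment_le[OF rs s ed(2) this, of K]
    random_scheme_eventually_ge[OF rs, of K] eventually_ge_at_top[of 1]
  show "\<forall>\<^sub>F n in sequentially. repeat_prob (P n) k < e"
  proof eventually_elim
    case (elim n)
    have "(ideal_time K)\<^sup>2 + c * repeat_prob (P n) k \<le> second_moment n (P n) K"
      unfolding c_def using second_moment_lower[OF random_scheme_subset[OF rs]] elim K(2) by blast
    then have "c * repeat_prob (P n) k < c * e" using elim le K(1) by simp
    then show ?case using c by simp
  qed
qed

section \<open>Achievability: concentration of the detection time\<close>

text \<open>
  Chebyshev's inequality about \<open>ideal_time K\<close>.  This need not be the mean of \<open>trunc_time P K\<close>, but it
  is a lower bound for it, so the mean square deviation is still at most
  \<open>second_moment n P K - (ideal_time K)\<^sup>2\<close>.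
\<close>

lemma trunc_time_deviation_prob:
  assumes P: "set_pmf P \<subseteq> detection_schemes n r" and K: "K \<le> r" and \<gamma>: "0 < \<gamma>"
  shows "measure_pmf.prob (conf_pmf \<Omega> n) {p. ideal_time K + \<gamma> \<le> trunc_time P K p}
    \<le> (real K)\<^sup>2 * repeat_prob P K / \<gamma>\<^sup>2"
proof -
  let ?E = "measure_pmf.expectation (conf_pmf \<Omega> n)" and ?U = "trunc_time P K" and ?g = "ideal_time K"
  let ?B = "{p. ?g + \<gamma> \<le> ?U p}"
  note int = integrable_conf_pmf
  have "\<gamma>\<^sup>2 * measure_pmf.prob (conf_pmf \<Omega> n) ?B = ?E (\<lambda>p. \<gamma>\<^sup>2 * indicator ?B p)"
    by simp
  also have "\<dots> \<le> ?E (\<lambda>p. (?U p)\<^sup>2 - 2 * ?g * ?U p + ?g\<^sup>2)"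
  proof (rule integral_mono[OF int int])
    fix p
    have sq: "(?U p)\<^sup>2 - 2 * ?g * ?U p + ?g\<^sup>2 = (?U p - ?g)\<^sup>2"
      by (simp add: power2_eq_square algebra_simps)
    show "\<gamma>\<^sup>2 * indicator ?B p \<le> (?U p)\<^sup>2 - 2 * ?g * ?U p + ?g\<^sup>2"
      unfolding sq using \<gamma> by (cases "p \<in> ?B") (auto intro!: power_mono)
  qed
  also have "\<dots> = second_moment n P K - 2 * ?g * ?E ?U + ?g\<^sup>2"
    unfolding second_moment_def
    by (subst Bochner_Integration.integral_add[OF int int],
        subst Bochner_Integration.integral_diff[OF int int]) simp
  also have "\<dots> \<le> second_moment n P K - 2 * ?g * ?g + ?g\<^sup>2"
    using mult_left_mono[OF mean_trunc_time_lower[OF P K], of "2 * ?g"] ideal_time_nonneg[of K] by simp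
  also have "\<dots> = second_moment n P K - ?g\<^sup>2" by (simp add: power2_eq_square)
  also have "\<dots> \<le> (real K)\<^sup>2 * repeat_prob P K" using second_moment_upper[OF P K] by simp
  finally show ?thesis using \<gamma> by (simp add: field_simps)
qed

text \<open>
  First \<open>K\<close> is chosen so large that the slots after \<open>K\<close> cost at most \<open>\<delta> / 2\<close> in every configuration; the
  other \<open>\<delta> / 2\<close> is the deviation of the time truncated at this fixed \<open>K\<close>, which has small probability
  for large \<open>n\<close>.
\<close>

lemma achieved_by_of_repeat_prob:
  assumes rs: "random_scheme r P" and rep: "\<And>k. k \<ge> 1 \<Longrightarrow> (\<lambda>n. repeat_prob (P n) k) \<longlonglongrightarrow> 0"
  shows "achieved_by \<Omega> r P (1 / (1 - q_av))"
proof -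
  have "\<exists>N\<ge>1. \<forall>n\<ge>N. achievability_condition \<Omega> n (r n) (P n) (1 / (1 - q_av)) \<epsilon> \<delta>"
    if ed: "0 < \<epsilon>" "0 < \<delta>" for \<epsilon> \<delta>
  proof -
    have pow: "(\<lambda>K. q_max ^ K) \<longlonglongrightarrow> 0"
      using q_max_pos q_max_less_1 by (intro LIMSEQ_realpow_zero) auto
    then have "(\<lambda>K. q_max ^ K / (1 - q_max)) \<longlonglongrightarrow> 0"
      using q_max_less_1 tendsto_divide[OF pow tendsto_const[of "1 - q_max"]] by simp
    then have "\<forall>\<^sub>F K in sequentially. q_max ^ K / (1 - q_max) < \<delta> / 2"
      by (rule order_tendstoD) (use ed in simp)
    then have "\<forall>\<^sub>F K in sequentially. q_max ^ K / (1 - q_max) < \<delta> / 2 \<and> K \<ge> 1"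
      using eventually_ge_at_top[of 1] by eventually_elim simp
    then obtain K where K: "q_max ^ K / (1 - q_max) < \<delta> / 2" "K \<ge> 1"
      unfolding eventually_sequentially by blast
    have "(\<lambda>n. (real K)\<^sup>2 * repeat_prob (P n) K / (\<delta> / 2)\<^sup>2) \<longlonglongrightarrow> 0"
      using tendsto_divide[OF tendsto_mult_left[OF rep[OF K(2)], of "(real K)\<^sup>2"]
          tendsto_const[of "(\<delta> / 2)\<^sup>2"]] ed by simp
    then have "\<forall>\<^sub>F n in sequentially. (real K)\<^sup>2 * repeat_prob (P n) K / (\<delta> / 2)\<^sup>2 < \<epsilon>"
      by (rule order_tendstoD) (use ed in simp)
    moreover have "(\<lambda>n. q_max ^ r n) \<longlonglongrightarrow> 0"
      using rs pow by (auto simp: random_scheme_def intro: filterlim_compose)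
    then have "\<forall>\<^sub>F n in sequentially. q_max ^ r n < \<epsilon>" using ed(1) by (rule order_tendstoD)
    ultimately have "\<forall>\<^sub>F n in sequentially. n \<ge> 1 \<and>
        achievability_condition \<Omega> n (r n) (P n) (1 / (1 - q_av)) \<epsilon> \<delta>"
      using random_scheme_eventually_ge[OF rs, of K] eventually_ge_at_top[of 1]
    proof eventually_elim
      case (elim n)
      have P: "set_pmf (P n) \<subseteq> detection_schemes n (r n)"
        using elim by (intro random_scheme_subset[OF rs])
      let ?C = "conf_pmf \<Omega> n"
      let ?B = "{p. ideal_time K + \<delta> / 2 \<le> trunc_time (P n) K p}"
      let ?G = "{p. detection_prob n (r n) (P n) p > 1 - \<epsilon> \<and>
        mean_detection_time n (r n) (P n) p < 1 / (1 - q_av) + \<delta>}"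
      have B: "measure_pmf.prob ?C ?B < \<epsilon>"
        using trunc_time_deviation_prob[OF P, of K "\<delta> / 2"] elim ed by auto
      have "p \<in> ?G" if p: "p \<in> set_pmf ?C" and "p \<notin> ?B" for p
      proof -
        note esc = escape_prob_bounds[OF p P]
        have mdt: "mean_detection_time n (r n) (P n) p \<le> trunc_time (P n) (r n) p"
          using mean_detection_time_eq[OF P, of p] conf_in_01[OF p] esc by simp
        have "detection_prob n (r n) (P n) p > 1 - \<epsilon>"
          using detection_prob_eq[OF P, of p] conf_in_01[OF p] esc elim by auto
        moreover have "mean_detection_time n (r n) (P n) p < 1 / (1 - q_av) + \<delta>"
        proof -
          have "trunc_time (P n) K p < ideal_time K + \<delta> / 2" using \<open>p \<notin> ?B\<close> by simp
          then show ?thesis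
            using mdt trunc_time_tail[OF p P, of K] elim K(1) ideal_time_le[of K] by linarith
        qed
        ultimately show ?thesis by simp
      qed
      then have "measure_pmf.prob ?C (- ?B) \<le> measure_pmf.prob ?C ?G"
        by (intro measure_pmf.finite_measure_mono_AE AE_pmfI) auto
      moreover have "measure_pmf.prob ?C (- ?B) = 1 - measure_pmf.prob ?C ?B"
        using measure_pmf.prob_compl[of ?B ?C] by (simp add: Compl_eq_Diff_UNIV)
      ultimately show ?case using B elim by (simp add: achievability_condition_def)
    qed
    then obtain N where N: "\<forall>n\<ge>N. n \<ge> 1 \<and>
        achievability_condition \<Omega> n (r n) (P n) (1 / (1 - q_av)) \<epsilon> \<delta>"
      unfolding eventually_sequentially by blast
    then show ?thesis by (intro exI[of _ N]) auto
  qed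
  then show ?thesis using rs q_av_less_1 by (simp add: achieved_by_def)
qed

end

section \<open>A capacity-achieving scheme\<close>

text \<open>
  With \<open>m = floor_sqrt n\<close>, cut the first \<open>m\<^sup>2\<close> detectors into \<open>m\<close> consecutive blocks of length \<open>m\<close> and
  query a uniformly random block.  Two independent copies share a detector only if they pick the same block, which has
  probability \<open>1 / m\<close>.
\<close>

definition block_scheme :: "nat \<Rightarrow> nat \<Rightarrow> nat \<Rightarrow> nat" where
  "block_scheme m u = (\<lambda>t\<in>{1..m}. u * m + t)"

definition random_block_scheme :: "nat \<Rightarrow> (nat \<Rightarrow> nat) pmf" where
  "random_block_scheme n =
     map_pmf (block_scheme (floor_sqrt n)) (pmf_of_set {..<floor_sqrt n})"

lemma block_scheme_in:
  assumes "u < floor_sqrt n"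
  shows "block_scheme (floor_sqrt n) u \<in> detection_schemes n (floor_sqrt n)"
proof -
  define m where "m = floor_sqrt n"
  have "u * m + t \<le> n" if "t \<le> m" for t
  proof -
    have "u * m + t \<le> Suc u * m" using that by simp
    also have "\<dots> \<le> m * m" using assms by (intro mult_le_mono1) (simp add: m_def)
    also have "\<dots> \<le> n" using floor_sqrt_power2_le[of n] by (simp add: m_def power2_eq_square)
    finally show ?thesis .
  qed
  then show ?thesis
    by (auto simp: block_scheme_def detection_schemes_def simp flip: m_def)
qed

lemma filterlim_floor_sqrt: "filterlim floor_sqrt at_top sequentially"
  unfolding filterlim_at_top eventually_sequentially le_floor_sqrt_iff
  by blast

lemma random_scheme_block: "random_scheme floor_sqrt random_block_scheme"
proof -
  have "set_pmf (random_block_scheme n) \<subseteq> detection_schemes n (floor_sqrt n)" if "n \<ge> 1" for n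
  proof -
    have "{..<floor_sqrt n} \<noteq> {}" using that by (simp add: lessThan_empty_iff)
    then show ?thesis using block_scheme_in by (auto simp: random_block_scheme_def)
  qed
  then show ?thesis
    using filterlim_floor_sqrt
    by (auto simp: random_scheme_def Suc_le_eq)
qed

lemma block_scheme_no_repeat:
  assumes "k \<le> m" "u \<noteq> v"
  shows "distinct (slots (block_scheme m u) k @ slots (block_scheme m v) k)"
proof -
  have inj: "distinct (slots (block_scheme m u) k)" for u
    using assms(1) by (auto simp: slots_def distinct_map inj_on_def block_scheme_def simp del: upt_Suc)
  \<comment> \<open>Block \<open>u\<close> ends with detector \<open>(u + 1) * m\<close>, and a later block starts after it.\<close>
  have less: "u * m + t < v * m + t'" if "u < v" "t \<le> m" "1 \<le> t'" for u v t t'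
  proof -
    have "u * m + t \<le> Suc u * m" using that by simp
    also have "\<dots> \<le> v * m" using that by (intro mult_le_mono1) simp
    finally show ?thesis using that by simp
  qed
  have ne: "u * m + t \<noteq> v * m + t'" if "t \<in> {1..k}" "t' \<in> {1..k}" for t t'
    using less[of u v t t'] less[of v u t' t] that assms by (cases u v rule: linorder_cases) auto
  have im: "set (slots (block_scheme m u) k) = (\<lambda>t. u * m + t) ` {1..k}" for u
    unfolding set_slots using assms(1) by (intro image_cong) (auto simp: block_scheme_def)
  have "set (slots (block_scheme m u) k) \<inter> set (slots (block_scheme m v) k) = {}"
  proof (rule equals0I)
    fix x assume x: "x \<in> set (slots (block_scheme m u) k) \<inter> set (slots (block_scheme m v) k)"
    have "x \<in> (\<lambda>t. u * m + t) ` {1..k}" using x im[of u] by blast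
    then obtain t where t: "t \<in> {1..k}" "x = u * m + t" by (rule imageE)
    have "x \<in> (\<lambda>t. v * m + t) ` {1..k}" using x im[of v] by blast
    then obtain t' where t': "t' \<in> {1..k}" "x = v * m + t'" by (rule imageE)
    from ne[OF t(1) t'(1)] t(2) t'(2) show False by simp
  qed
  then show ?thesis using inj by simp
qed

lemma repeat_prob_random_block_scheme:
  assumes "1 \<le> n" "k \<le> floor_sqrt n"
  shows "repeat_prob (random_block_scheme n) k \<le> 1 / floor_sqrt n"
proof -
  define m where "m = floor_sqrt n"
  have m: "m > 0" using assms(1) by (simp add: m_def)
  define U where "U = pmf_of_set {..<m}"
  have ne: "{..<m} \<noteq> {}" using m by (simp add: lessThan_empty_iff)
  have finU: "finite (set_pmf U)" using ne by (simp add: U_def)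
  have pair: "pair_pmf (random_block_scheme n) (random_block_scheme n) =
      map_pmf (\<lambda>(u, v). (block_scheme m u, block_scheme m v)) (pair_pmf U U)"
    by (simp only: random_block_scheme_def U_def m_def map_pair)
  have "repeat_prob (random_block_scheme n) k = measure_pmf.prob (pair_pmf U U)
      {z. \<not> distinct (slots (block_scheme m (fst z)) k @ slots (block_scheme m (snd z)) k)}"
    unfolding repeat_prob_def pair measure_map_pmf
    by (simp only: vimage_def mem_Collect_eq case_prod_beta fst_conv snd_conv)
  also have "\<dots> \<le> measure_pmf.prob (pair_pmf U U) {z. snd z = fst z}"
  proof (rule measure_pmf.finite_measure_mono)
    show "{z. \<not> distinct (slots (block_scheme m (fst z)) k @ slots (block_scheme m (snd z)) k)}
        \<subseteq> {z. snd z = fst z}"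
      using block_scheme_no_repeat[OF assms(2)] unfolding m_def by (metis (mono_tags, lifting) Collect_mono)
  qed simp
  also have "\<dots> = measure_pmf.expectation (pair_pmf U U) (indicator {z. snd z = fst z})"
    by simp
  also have "\<dots> = measure_pmf.expectation U (\<lambda>u. measure_pmf.expectation U (indicator {u}))"
    unfolding expectation_pair_pmf_iterated[OF finU finU]
    by (intro Bochner_Integration.integral_cong refl) (auto simp: indicator_def)
  also have "\<dots> = measure_pmf.expectation U (\<lambda>u. pmf U u)"
    by (simp add: measure_pmf_single)
  also have "\<dots> \<le> 1 / m"
    using ne by (intro measure_pmf.integral_le_const integrable_measure_pmf_finite finU AE_pmfI)
      (auto simp: U_def)
  finally show ?thesis by (simp add: m_def)
qed

lemma repeat_prob_random_block_scheme_tendsto: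
  "(\<lambda>n. repeat_prob (random_block_scheme n) k) \<longlonglongrightarrow> 0"
proof (rule tendsto_sandwich[OF _ _ tendsto_const])
  show "\<forall>\<^sub>F n in sequentially. repeat_prob (random_block_scheme n) k \<le> 1 / real (floor_sqrt n)"
    using eventually_ge_at_top[of 1] filterlim_floor_sqrt[unfolded filterlim_at_top, rule_format, of k]
    by eventually_elim (rule repeat_prob_random_block_scheme)
  show "(\<lambda>n. 1 / real (floor_sqrt n)) \<longlonglongrightarrow> 0"
    using filterlim_compose[OF lim_1_over_n filterlim_floor_sqrt] by simp
qed (simp add: repeat_prob_def)

section \<open>The detection capacity\<close>

theorem theorem1:
  fixes \<Omega> :: "real set"
  assumes "finite \<Omega>" and "\<Omega> \<noteq> {}" and "\<Omega> \<subseteq> {0<..<1}"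
  shows "T_cap \<Omega> = ereal (1 / p_av \<Omega>) \<and>
    (\<forall>r P. random_scheme r P \<longrightarrow>
       (let a1 = (\<forall>k\<ge>1. (\<lambda>n. distinct_prob (P n) k) \<longlonglongrightarrow> 1);
            a2 = (\<forall>k\<ge>1. (\<lambda>n. disjoint_prob (P n) k) \<longlonglongrightarrow> 1);
            achieves = achieved_by \<Omega> r P (real_of_ereal (T_cap \<Omega>))
        in (card \<Omega> \<ge> 2 \<longrightarrow> (achieves \<longleftrightarrow> a1 \<and> a2)) \<and>
           (a1 \<and> a2 \<longrightarrow> achieves)))"
proof -
  interpret detector_probabilities \<Omega> using assms by unfold_locales
  have s: "1 / p_av \<Omega> = 1 / (1 - q_av)" by (simp add: p_av_eq)
  have "achieved_by \<Omega> floor_sqrt random_block_scheme (1 / p_av \<Omega>)"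
    unfolding s by (intro achieved_by_of_repeat_prob random_scheme_block
        repeat_prob_random_block_scheme_tendsto)
  then have "achievable \<Omega> (1 / p_av \<Omega>)"
    unfolding achieved_by_def achievable_def by blast
  then have cap: "T_cap \<Omega> = ereal (1 / p_av \<Omega>)"
    unfolding T_cap_def using achievable_ge
    by (intro antisym Inf_lower Inf_greatest) (auto simp: s)
  have suff: "achieved_by \<Omega> r P (1 / p_av \<Omega>)"
    if "random_scheme r P" "\<forall>k\<ge>1. (\<lambda>n. repeat_prob (P n) k) \<longlonglongrightarrow> 0" for r P
    unfolding s using that by (intro achieved_by_of_repeat_prob) auto
  have nec: "\<forall>k\<ge>1. (\<lambda>n. repeat_prob (P n) k) \<longlonglongrightarrow> 0"
    if "card \<Omega> \<ge> 2" "achieved_by \<Omega> r P (1 / p_av \<Omega>)" for r P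
    using repeat_prob_tendsto_0_of_achieved[OF that(1)] that(2) unfolding s by blast
  show ?thesis
    unfolding Let_def cap real_of_ereal.simps repeat_prob_tendsto_0_iff[symmetric]
    using suff nec by blast
qed

end
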